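(* Let $p\equiv 1\pmod 3$ be a prime, let $a$ be an element of multiplicative order $3$ in $\mathbb{Z}_p$, and let $\Sigma$ be the bipartite graph with vertex set $\mathbb{Z}_p\times\mathbb{Z}_p\times\mathbb{Z}_2$ whose edges are, for $x,y\in\mathbb{Z}_p$, the pairs $$\{(x,y,0),(x+1,y+1,1)\},\quad \{(x,y,0),(x+a,y+a^2,1)\},\quad \{(x,y,0),(x+a^2,y+a,1)\}.$$ Define the following automorphisms of $\Sigma$: $t_{u,v}:(x,y,\epsilon)\mapsto(x+u,y+v,\epsilon)$ for $u,v\in\mathbb{Z}_p$, $\tau:(x,y,\epsilon)\mapsto(ax,a^2y,\epsilon)$, $\sigma:(x,y,\epsilon)\mapsto(y,x,\epsilon)$, $\nu:(x,y,\epsilon)\mapsto(-x,-y,1-\epsilon)$, and let $N=\{t_{u,v}\mid u,v\in\mathbb{Z}_p\}\cong\mathbb{Z}_p^2$. Let $G=N\rtimes\langle\tau,\sigma\nu\rangle\cong\mathbb{Z}_p^2\rtimes S_3$. Then $G$ is biquasiprimitive on $V\Sigma$ but $G^+$ is not quasiprimitive on each bipartite half, and $\Sigma$ is $(G,1)$-arc transitive but not $(G,2)$-arc transitive. The full automorphism group of $\Sigma$ is $A=N\rtimes\langle\tau,\sigma,\nu\rangle\cong\mathbb{Z}_p^2\rtimes(S_3\times\mathbb{Z}_2)$. Moreover $\Sigma$ is $(A,2)$-arc transitive, $A$ is biquasiprimitive on $V\Sigma$, and $A^+$ is quasiprimitive on the bipartite halves.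
   Context: The bipartite halves of $\Sigma$ are $\{(x,y,0)\mid x,y\in\mathbb{Z}_p\}$ and $\{(x,y,1)\mid x,y\in\mathbb{Z}_p\}$. An $s$-arc is an $(s+1)$-tuple $(v_0,\dots,v_s)$ of vertices with consecutive vertices adjacent and $v_{j-1}\ne v_{j+1}$ for $1\le j\le s-1$. A connected graph is $(G,s)$-arc transitive if it has an $s$-arc and $G$ is transitive on the set of $i$-arcs for each $1\le i\le s$. A transitive permutation group is quasiprimitive if all its nontrivial normal subgroups are transitive; it is biquasiprimitive if it is not quasiprimitive and all its nontrivial normal subgroups have at most two orbits. A group acting transitively on a set is quasiprimitive on it if the induced permutation group is quasiprimitive. For a vertex-transitive group $X$ of automorphisms, $X^+$ denotes the (index two) subgroup generated by all vertex stabilisers $X_v$; its orbits are the two bipartite halves. "$G^+$ is not quasiprimitive on each bipartite half" means that it is quasiprimitive on neither of them (the two actions being equivalent). *)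

theory Defs
  imports
    "HOL-Algebra.Group_Action"
    "HOL-Algebra.Generated_Groups"
    "HOL-Algebra.Elementary_Groups"
    "HOL-Algebra.Sym_Groups"
    "HOL-Number_Theory.Cong"
    "HOL-Library.Z2"
    "Berlekamp_Zassenhaus.Finite_Field"
begin

section \<open>Permutation groups\<close>

text \<open>A permutation group on \<open>V\<close> is a subgroup \<open>X\<close> of the library's \<^const>\<open>BijGroup\<close>,
  given by its set of elements; it acts on \<open>V\<close> by evaluation.\<close>

definition perm_group :: "'v set \<Rightarrow> ('v \<Rightarrow> 'v) set \<Rightarrow> ('v \<Rightarrow> 'v) monoid" where
  "perm_group V X = BijGroup V\<lparr>carrier := X\<rparr>"

definition transitive_perm :: "'v set \<Rightarrow> ('v \<Rightarrow> 'v) set \<Rightarrow> bool" where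
  "transitive_perm V X \<longleftrightarrow> transitive_action (perm_group V X) V (\<lambda>g. g)"

definition perm_orbits :: "'v set \<Rightarrow> ('v \<Rightarrow> 'v) set \<Rightarrow> 'v set set" where
  "perm_orbits V X = orbits (perm_group V X) V (\<lambda>g. g)"

definition nontrivial_normal :: "'v set \<Rightarrow> ('v \<Rightarrow> 'v) set \<Rightarrow> ('v \<Rightarrow> 'v) set \<Rightarrow> bool" where
  "nontrivial_normal V X M \<longleftrightarrow>
     M \<lhd> perm_group V X \<and> M \<noteq> {\<one>\<^bsub>BijGroup V\<^esub>}"

definition quasiprimitive :: "'v set \<Rightarrow> ('v \<Rightarrow> 'v) set \<Rightarrow> bool" where
  "quasiprimitive V X \<longleftrightarrow>
     transitive_perm V X \<and> (\<forall>M. nontrivial_normal V X M \<longrightarrow> transitive_perm V M)"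

definition biquasiprimitive :: "'v set \<Rightarrow> ('v \<Rightarrow> 'v) set \<Rightarrow> bool" where
  "biquasiprimitive V X \<longleftrightarrow>
     transitive_perm V X \<and> \<not> quasiprimitive V X \<and>
     (\<forall>M. nontrivial_normal V X M \<longrightarrow> finite (perm_orbits V M) \<and> card (perm_orbits V M) \<le> 2)"

text \<open>The group induced on an invariant subset \<open>B\<close>; elements of \<^term>\<open>BijGroup B\<close> are
  extensional, hence the restriction.\<close>

definition induced :: "('v \<Rightarrow> 'v) set \<Rightarrow> 'v set \<Rightarrow> ('v \<Rightarrow> 'v) set" where
  "induced X B = (\<lambda>g. restrict g B) ` X"

definition quasiprimitive_on :: "('v \<Rightarrow> 'v) set \<Rightarrow> 'v set \<Rightarrow> bool" where
  "quasiprimitive_on X B \<longleftrightarrow> quasiprimitive B (induced X B)"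

definition plus_subgroup :: "'v set \<Rightarrow> ('v \<Rightarrow> 'v) set \<Rightarrow> ('v \<Rightarrow> 'v) set" where
  "plus_subgroup V X =
     generate (BijGroup V) (\<Union>v\<in>V. stabilizer (perm_group V X) (\<lambda>g. g) v)"

definition internal_semidirect :: "('g, 'm) monoid_scheme \<Rightarrow> 'g set \<Rightarrow> 'g set \<Rightarrow> bool" where
  "internal_semidirect P N H \<longleftrightarrow>
     N \<lhd> P \<and> subgroup H P \<and> N \<inter> H = {\<one>\<^bsub>P\<^esub>} \<and> N <#>\<^bsub>P\<^esub> H = carrier P"


section \<open>Graphs with vertex set \<open>V\<close> and set \<open>E\<close> of unordered edges\<close>

definition automorphisms :: "'v set \<Rightarrow> 'v set set \<Rightarrow> ('v \<Rightarrow> 'v) set" where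
  "automorphisms V E = {g \<in> Bij V. \<forall>u\<in>V. \<forall>v\<in>V. {u, v} \<in> E \<longleftrightarrow> {g u, g v} \<in> E}"

definition connected_graph :: "'v set \<Rightarrow> 'v set set \<Rightarrow> bool" where
  "connected_graph V E \<longleftrightarrow>
     V \<noteq> {} \<and> (\<forall>u\<in>V. \<forall>v\<in>V. (u, v) \<in> {(x, y). x \<in> V \<and> y \<in> V \<and> {x, y} \<in> E}\<^sup>*)"

definition arcs :: "'v set \<Rightarrow> 'v set set \<Rightarrow> nat \<Rightarrow> 'v list set" where
  "arcs V E s = {vs. length vs = s + 1 \<and> set vs \<subseteq> V \<and>
     (\<forall>j<s. {vs ! j, vs ! (j + 1)} \<in> E) \<and>
     (\<forall>j. 1 \<le> j \<and> j < s \<longrightarrow> vs ! (j - 1) \<noteq> vs ! (j + 1))}"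

definition arc_transitive :: "'v set \<Rightarrow> 'v set set \<Rightarrow> ('v \<Rightarrow> 'v) set \<Rightarrow> nat \<Rightarrow> bool" where
  "arc_transitive V E X s \<longleftrightarrow>
     connected_graph V E \<and> arcs V E s \<noteq> {} \<and>
     (\<forall>i. 1 \<le> i \<and> i \<le> s \<longrightarrow>
        (\<forall>vs\<in>arcs V E i. \<forall>ws\<in>arcs V E i. \<exists>g\<in>X. map g vs = ws))"


section \<open>The graph \<open>\<Sigma>\<close> and its automorphisms\<close>

definition has_mult_order :: "'a::monoid_mult \<Rightarrow> nat \<Rightarrow> bool" where
  "has_mult_order a n \<longleftrightarrow> 0 < n \<and> a ^ n = 1 \<and> (\<forall>k. 0 < k \<and> k < n \<longrightarrow> a ^ k \<noteq> 1)"

text \<open>\<open>'p mod_ring\<close> is the ring of integers modulo \<open>CARD('p)\<close>, which is prime for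
  \<open>'p :: prime_card\<close>; \<^typ>\<open>bit\<close> is the ring of integers modulo 2.\<close>

type_synonym 'p vert = "'p mod_ring \<times> 'p mod_ring \<times> bit"

definition Sigma_edges :: "'p::prime_card mod_ring \<Rightarrow> 'p vert set set" where
  "Sigma_edges a =
     (\<Union>x. \<Union>y. {{(x, y, 0), (x + 1, y + 1, 1)},
                {(x, y, 0), (x + a, y + a\<^sup>2, 1)},
                {(x, y, 0), (x + a\<^sup>2, y + a, 1)}})"

definition half :: "bit \<Rightarrow> 'p::prime_card vert set" where
  "half e = {(x, y, e) | x y. True}"

definition transl :: "'p::prime_card mod_ring \<Rightarrow> 'p mod_ring \<Rightarrow> 'p vert \<Rightarrow> 'p vert" where
  "transl u v = (\<lambda>(x, y, e). (x + u, y + v, e))"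

definition tau :: "'p::prime_card mod_ring \<Rightarrow> 'p vert \<Rightarrow> 'p vert" where
  "tau a = (\<lambda>(x, y, e). (a * x, a\<^sup>2 * y, e))"

definition sigma :: "'p::prime_card vert \<Rightarrow> 'p vert" where
  "sigma = (\<lambda>(x, y, e). (y, x, e))"

definition nu :: "'p::prime_card vert \<Rightarrow> 'p vert" where
  "nu = (\<lambda>(x, y, e). (- x, - y, 1 - e))"

definition N_group :: "('p::prime_card vert \<Rightarrow> 'p vert) set" where
  "N_group = {transl u v | u v. True}"

definition G_compl :: "'p::prime_card mod_ring \<Rightarrow> ('p vert \<Rightarrow> 'p vert) set" where
  "G_compl a = generate (BijGroup UNIV) {tau a, sigma \<circ> nu}"

definition A_compl :: "'p::prime_card mod_ring \<Rightarrow> ('p vert \<Rightarrow> 'p vert) set" where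
  "A_compl a = generate (BijGroup UNIV) {tau a, sigma, nu}"

definition G_group :: "'p::prime_card mod_ring \<Rightarrow> ('p vert \<Rightarrow> 'p vert) set" where
  "G_group a = N_group <#>\<^bsub>BijGroup UNIV\<^esub> G_compl a"

definition A_group :: "'p::prime_card mod_ring \<Rightarrow> ('p vert \<Rightarrow> 'p vert) set" where
  "A_group a = N_group <#>\<^bsub>BijGroup UNIV\<^esub> A_compl a"

end

theory Submission
  imports Defs
begin

text \<open>
  Fixing a vertex and its three neighbours forces an automorphism to be trivial: the three offsets
  \<open>(q, q\<^sup>2)\<close>, for \<open>q\<close> a cube root of unity, are affinely independent and \<open>p > 3\<close>, so \<open>\<Sigma>\<close> looks
  locally like the hexagonal lattice, with exactly one hexagon through each 2-arc. Since \<open>A\<close> is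
  transitive on 2-arcs, it is the full automorphism group. For the quasiprimitivity statements,
  \<open>\<int>\<^sub>p\<^sup>2\<close> is the sum of the two eigenlines of \<open>\<tau>\<close>, which are exchanged by every element inducing a
  coordinate swap. Hence \<open>N\<close> is the unique minimal normal subgroup of every group under consideration
  that contains a swap, namely \<open>G\<close>, \<open>A\<close> and \<open>A\<^sup>+\<close>; but \<open>G\<^sup>+ = N \<rtimes> \<langle>\<tau>\<rangle>\<close> normalises an eigenline.
\<close>

(* Otherwise the simplifier rewrites d + d' to of_bool (odd d \<noteq> odd d'), which loses the group structure. *)
declare add_bit_eq_xor [simp del]


section \<open>Affine maps\<close>

text \<open>Every group in the statement is \<open>Aff C\<close> for a set \<open>C\<close> of types
  \<open>(s, d)\<close> that is a subgroup of the Klein four-group: all types for A, the diagonal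
  for G. Passing to the subgroup generated by the stabilisers keeps exactly the types with
  \<open>d = 0\<close>. So each property is reduced to memberships in \<open>C\<close>: some
  \<open>(True, d)\<close> makes \<open>N_group\<close> the least nontrivial normal subgroup, some
  \<open>(s, 1)\<close> exchanges the halves, and \<open>(True, 0)\<close>, a swap preserving the
  halves, is what quasiprimitivity on the halves and the reversal of a 2-arc call for. In G every
  swap also exchanges the halves, which is why G loses these two properties and is still
  biquasiprimitive.

  Minimality of \<open>N_group\<close> has two stages: commutators with translations produce a
  nontrivial translation in any nontrivial normal subgroup, and irreducibility then yields all
  translations.

  Agreement with an affine map on one 2-arc is enough to invoke rigidity, because valency three
  leaves no choice for the last neighbour of its middle vertex.\<close>

definition sg :: "bit \<Rightarrow> 'p::prime_card mod_ring" where
  "sg d = (if d = 0 then 1 else - 1)"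

text \<open>\<open>aff r s d u v\<close> is \<open>transl u v\<close> composed with the diagonal map \<open>(r, r\<^sup>2)\<close>, with
  \<^const>\<open>sigma\<close> if \<open>s\<close> holds, and with \<^const>\<open>nu\<close> if \<open>d = 1\<close>. The sets \<open>Aff C\<close> and
  \<open>Lin C\<close> below restrict the type \<open>(s, d)\<close> to \<open>C\<close>.\<close>

definition aff :: "'p::prime_card mod_ring \<Rightarrow> bool \<Rightarrow> bit \<Rightarrow> 'p mod_ring \<Rightarrow> 'p mod_ring \<Rightarrow> 'p vert \<Rightarrow> 'p vert" where
  "aff r s d u v = (\<lambda>(x, y, e).
     (sg d * r * (if s then y else x) + u, sg d * r\<^sup>2 * (if s then x else y) + v, e + d))"

lemma sg_simps [simp]: "sg 0 = 1" "sg 1 = - 1" "sg d * sg d = 1" "sg d * (sg d * z) = z"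
  by (auto simp: sg_def)

lemma sg_add: "sg (d + d') = sg d * sg d'"
  by (cases d; cases d') (auto simp: sg_def)

lemma sg_neq_0 [simp]: "sg d \<noteq> 0"
  by (auto simp: sg_def)

lemma bit_cancel [simp]: "e + d + d = (e::bit)" "d + d = 0"
  by (cases e; cases d; simp)+

lemma transl_aff: "transl u v = aff 1 False 0 u v"
  by (auto simp: transl_def aff_def)

lemma tau_aff: "tau a = aff a False 0 0 0"
  by (auto simp: tau_def aff_def)

lemma sigma_aff: "sigma = aff 1 True 0 0 0"
  by (auto simp: sigma_def aff_def)

lemma nu_aff: "nu = aff 1 False 1 0 0"
  by (auto simp: nu_def aff_def add.commute)

lemma sigma_nu_aff: "sigma \<circ> nu = aff 1 True 1 0 0"
  by (auto simp: nu_def sigma_def aff_def add.commute fun_eq_iff)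

text \<open>A swap exchanges the two entries of \<open>(r', r'\<^sup>2)\<close>, and
  \<open>(r'\<^sup>2, r')\<close> is again of the required form, for the root
  \<open>r'\<^sup>2\<close>, because \<open>r' ^ 4 = r'\<close>.\<close>

lemma aff_comp:
  assumes "r' ^ 3 = 1"
  shows "aff r s d u v \<circ> aff r' s' d' u' v' =
    aff (r * (if s then r'\<^sup>2 else r')) (s \<noteq> s') (d + d')
      (sg d * r * (if s then v' else u') + u) (sg d * r\<^sup>2 * (if s then u' else v') + v)"
proof -
  have *: "r' ^ 4 = r'"
    using assms by (simp add: eval_nat_numeral mult.assoc)
  show ?thesis
    by (auto simp: aff_def fun_eq_iff sg_add power_mult_distrib * algebra_simps)
qed

lemma aff_id: "aff 1 False 0 0 0 = id"
  by (auto simp: aff_def)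

lemma cube_inverse: "r ^ 3 = (1 :: 'a::monoid_mult) \<Longrightarrow> r * r\<^sup>2 = 1" "r ^ 3 = (1 :: 'a::monoid_mult) \<Longrightarrow> r\<^sup>2 * r = 1"
  by (simp_all add: eval_nat_numeral mult.assoc)

lemma cube_fourth: "r ^ 3 = (1 :: 'a::monoid_mult) \<Longrightarrow> (r\<^sup>2)\<^sup>2 = r"
  by (simp add: eval_nat_numeral mult.assoc)

lemma cube_square: "r ^ 3 = (1 :: 'a::monoid_mult) \<Longrightarrow> (r\<^sup>2) ^ 3 = 1"
  by (metis power_mult mult.commute power_one)

lemma cube_mult: "r ^ 3 = 1 \<Longrightarrow> q ^ 3 = 1 \<Longrightarrow> (r * q) ^ 3 = (1 :: 'a::comm_monoid_mult)"
  by (simp add: power_mult_distrib)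

text \<open>The type of a map is its own inverse. With a swap the linear part is an involution,
  since \<open>r * r\<^sup>2 = 1\<close>, so \<open>r\<close> is kept; without one, \<open>r\<close>
  is inverted to \<open>r\<^sup>2\<close>.\<close>

lemma aff_inverse:
  fixes r :: "'p::prime_card mod_ring"
  assumes "r ^ 3 = 1"
  obtains u' v' where
    "aff (if s then r else r\<^sup>2) s d u' v' \<circ> aff r s d u v = id"
    "aff r s d u v \<circ> aff (if s then r else r\<^sup>2) s d u' v' = id"
proof -
  define r' where "r' = (if s then r else r\<^sup>2)"
  define u' where "u' = - sg d * r' * (if s then v else u)"
  define v' where "v' = - sg d * r'\<^sup>2 * (if s then u else v)"
  have r4: "r * r * r = 1"
    using assms by (simp add: eval_nat_numeral mult.assoc)
  have r3: "r' ^ 3 = 1"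
    using assms cube_square[OF assms] by (simp add: r'_def)
  have rr: "r * (r * r) = 1" "r * (r * (r * z)) = z" for z
    using r4 by (simp_all flip: mult.assoc)
  have "aff r' s d u' v' \<circ> aff r s d u v = id"
    by (subst aff_comp[OF assms]; subst aff_id[symmetric])
       (auto simp: r'_def u'_def v'_def rr power2_eq_square mult.assoc)
  moreover have "aff r s d u v \<circ> aff r' s d u' v' = id"
    by (subst aff_comp[OF r3]; subst aff_id[symmetric])
       (auto simp: r'_def u'_def v'_def rr power2_eq_square mult.assoc mult.left_commute[of r "sg d"])
  ultimately show ?thesis
    using that unfolding r'_def by blast
qed

lemma bij_aff: "r ^ 3 = 1 \<Longrightarrow> bij (aff r s d u v)"
  by (metis aff_inverse o_bij)

section \<open>Groups of affine maps\<close>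

definition Aff :: "(bool \<times> bit) set \<Rightarrow> ('p::prime_card vert \<Rightarrow> 'p vert) set" where
  "Aff C = {aff r s d u v | r s d u v. r ^ 3 = 1 \<and> (s, d) \<in> C}"

definition Lin :: "(bool \<times> bit) set \<Rightarrow> ('p::prime_card vert \<Rightarrow> 'p vert) set" where
  "Lin C = {aff r s d 0 0 | r s d. r ^ 3 = 1 \<and> (s, d) \<in> C}"

text \<open>A subgroup of the Klein four-group; closure under inverses is automatic, every element
  being its own inverse.\<close>

definition type_subgroup :: "(bool \<times> bit) set \<Rightarrow> bool" where
  "type_subgroup C \<longleftrightarrow> (False, 0) \<in> C \<and>
     (\<forall>s d s' d'. (s, d) \<in> C \<longrightarrow> (s', d') \<in> C \<longrightarrow> (s \<noteq> s', d + d') \<in> C)"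

lemma type_subgroup_UNIV: "type_subgroup UNIV"
  by (simp add: type_subgroup_def)

section \<open>The bijections of the whole vertex type as a group under composition\<close>

lemma carrier_perm_group [simp]: "carrier (perm_group V X) = X"
  by (simp add: perm_group_def)

lemma mult_perm_group [simp]: "monoid.mult (perm_group V X) = monoid.mult (BijGroup V)"
  by (simp add: perm_group_def)

lemma one_perm_group [simp]: "one (perm_group V X) = one (BijGroup V)"
  by (simp add: perm_group_def)

lemma one_BijGroup_UNIV [simp]: "one (BijGroup UNIV) = id"
  by (simp add: BijGroup_def fun_eq_iff)

lemma mem_Bij_UNIV [simp]: "g \<in> Bij UNIV \<longleftrightarrow> bij g"
  by (simp add: Bij_def)

lemma carrier_BijGroup [simp]: "carrier (BijGroup V) = Bij V"
  by (simp add: BijGroup_def)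

lemma mult_BijGroup: "g \<in> Bij V \<Longrightarrow> h \<in> Bij V \<Longrightarrow> g \<otimes>\<^bsub>BijGroup V\<^esub> h = compose V g h"
  by (simp add: BijGroup_def)

lemma mult_BijGroup_UNIV: "bij g \<Longrightarrow> bij h \<Longrightarrow> g \<otimes>\<^bsub>BijGroup UNIV\<^esub> h = g \<circ> h"
  by (simp add: mult_BijGroup compose_def fun_eq_iff)

lemma inv_BijGroup_UNIV:
  assumes "bij g" "h \<circ> g = id"
  shows "inv\<^bsub>BijGroup UNIV\<^esub> g = h"
proof (rule group.inv_equality[OF group_BijGroup])
  have "h = inv_into UNIV g"
    using assms by (metis bij_is_surj comp_assoc comp_id id_comp surj_iff)
  then have "bij h"
    using assms by (simp add: bij_imp_bij_inv)
  then show "h \<otimes>\<^bsub>BijGroup UNIV\<^esub> g = \<one>\<^bsub>BijGroup UNIV\<^esub>" "g \<in> carrier (BijGroup UNIV)" "h \<in> carrier (BijGroup UNIV)"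
    using assms by (simp_all add: mult_BijGroup_UNIV)
qed

lemma subgroup_BijGroup_UNIV_I:
  assumes "\<And>g. g \<in> X \<Longrightarrow> bij g" "id \<in> X" "\<And>g h. g \<in> X \<Longrightarrow> h \<in> X \<Longrightarrow> g \<circ> h \<in> X"
    "\<And>g. g \<in> X \<Longrightarrow> \<exists>h\<in>X. h \<circ> g = id"
  shows "subgroup X (BijGroup UNIV)"
proof (rule group.subgroupI[OF group_BijGroup])
  fix g assume "g \<in> X"
  then show "inv\<^bsub>BijGroup UNIV\<^esub> g \<in> X"
    using assms inv_BijGroup_UNIV by metis
qed (use assms in \<open>auto simp: mult_BijGroup_UNIV\<close>)

lemma AffE:
  assumes "g \<in> Aff C"
  obtains r s d u v where "g = aff r s d u v" "r ^ 3 = 1" "(s, d) \<in> C"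
  using assms by (auto simp: Aff_def)

lemma LinE:
  assumes "g \<in> Lin C"
  obtains r s d where "g = aff r s d 0 0" "r ^ 3 = 1" "(s, d) \<in> C"
  using assms by (auto simp: Lin_def)

lemma aff_in_Aff: "r ^ 3 = 1 \<Longrightarrow> (s, d) \<in> C \<Longrightarrow> aff r s d u v \<in> Aff C"
  unfolding Aff_def by blast

lemma aff_in_Lin: "r ^ 3 = 1 \<Longrightarrow> (s, d) \<in> C \<Longrightarrow> aff r s d 0 0 \<in> Lin C"
  by (auto simp: Lin_def)

lemma Aff_bij: "g \<in> Aff C \<Longrightarrow> bij g"
  by (elim AffE) (simp add: bij_aff)

lemma Lin_subset_Aff: "Lin C \<subseteq> Aff C"
  by (auto simp: Lin_def intro: aff_in_Aff)

lemma subgroup_Aff: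
  assumes "type_subgroup C"
  shows "subgroup (Aff C :: ('p::prime_card vert \<Rightarrow> 'p vert) set) (BijGroup UNIV)"
proof (rule subgroup_BijGroup_UNIV_I)
  show "id \<in> Aff C"
    using assms aff_in_Aff[of 1 False 0 C 0 0] by (simp add: aff_id type_subgroup_def)
next
  fix g h :: "'p vert \<Rightarrow> 'p vert" assume "g \<in> Aff C" "h \<in> Aff C"
  then obtain r s d u v r' s' d' u' v'
    where gh: "g = aff r s d u v" "h = aff r' s' d' u' v'" and r: "r ^ 3 = 1" "r' ^ 3 = 1"
      and C: "(s, d) \<in> C" "(s', d') \<in> C"
    by (elim AffE)
  have "(r * (if s then r'\<^sup>2 else r')) ^ 3 = 1"
    using r by (auto intro: cube_mult cube_square)
  moreover have "(s \<noteq> s', d + d') \<in> C"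
    using C assms unfolding type_subgroup_def by blast
  ultimately show "g \<circ> h \<in> Aff C"
    unfolding gh aff_comp[OF r(2)] by (auto intro: aff_in_Aff)
next
  fix g :: "'p vert \<Rightarrow> 'p vert" assume "g \<in> Aff C"
  then obtain r s d u v where g: "g = aff r s d u v" "r ^ 3 = 1" "(s, d) \<in> C"
    by (elim AffE)
  obtain u' v' where "aff (if s then r else r\<^sup>2) s d u' v' \<circ> g = id"
    using aff_inverse g by metis
  moreover have "aff (if s then r else r\<^sup>2) s d u' v' \<in> Aff C"
    using g by (auto intro!: aff_in_Aff cube_square)
  ultimately show "\<exists>h\<in>Aff C. h \<circ> g = id"
    by blast
qed (rule Aff_bij)

lemma subgroup_Lin:
  assumes "type_subgroup C"
  shows "subgroup (Lin C :: ('p::prime_card vert \<Rightarrow> 'p vert) set) (BijGroup UNIV)"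
proof (rule subgroup_BijGroup_UNIV_I)
  show "id \<in> Lin C"
    using assms aff_in_Lin[of 1 False 0 C] by (simp add: aff_id type_subgroup_def)
next
  fix g h :: "'p vert \<Rightarrow> 'p vert" assume "g \<in> Lin C" "h \<in> Lin C"
  then obtain r s d r' s' d'
    where gh: "g = aff r s d 0 0" "h = aff r' s' d' 0 0" and r: "r ^ 3 = 1" "r' ^ 3 = 1"
      and C: "(s, d) \<in> C" "(s', d') \<in> C"
    by (elim LinE)
  have "(r * (if s then r'\<^sup>2 else r')) ^ 3 = 1"
    using r by (auto intro: cube_mult cube_square)
  moreover have "(s \<noteq> s', d + d') \<in> C"
    using C assms unfolding type_subgroup_def by blast
  ultimately show "g \<circ> h \<in> Lin C"
    unfolding gh aff_comp[OF r(2)] by (auto intro: aff_in_Lin)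
next
  fix g :: "'p vert \<Rightarrow> 'p vert" assume "g \<in> Lin C"
  then obtain r s d where g: "g = aff r s d 0 0" "r ^ 3 = 1" "(s, d) \<in> C"
    by (elim LinE)
  have r: "(if s then r else r\<^sup>2) ^ 3 = 1"
    using g cube_square by auto
  have "aff (if s then r else r\<^sup>2) s d 0 0 \<circ> g = id"
    using g(2) unfolding g(1) aff_comp[OF g(2)] aff_id[symmetric]
    by (simp add: cube_inverse)
  moreover have "aff (if s then r else r\<^sup>2) s d 0 0 \<in> Lin C"
    using g r by (auto intro!: aff_in_Lin)
  ultimately show "\<exists>h\<in>Lin C. h \<circ> g = id"
    by blast
qed (use Lin_subset_Aff Aff_bij in blast)


section \<open>Subgroups of permutation groups, and groups of translations\<close>

lemma group_perm_group: "subgroup X (BijGroup V) \<Longrightarrow> group (perm_group V X)"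
  unfolding perm_group_def by (rule group.subgroup_imp_group[OF group_BijGroup])

lemma inv_perm_group:
  "subgroup X (BijGroup V) \<Longrightarrow> g \<in> X \<Longrightarrow> inv\<^bsub>perm_group V X\<^esub> g = inv\<^bsub>BijGroup V\<^esub> g"
  unfolding perm_group_def by (rule group.m_inv_consistent[OF group_BijGroup])

lemma subgroup_perm_group:
  assumes "subgroup X (BijGroup V)"
  shows "subgroup M (perm_group V X) \<longleftrightarrow> subgroup M (BijGroup V) \<and> M \<subseteq> X"
  using assms group.subgroup_incl[OF group_BijGroup, of M V X]
    group.incl_subgroup[OF group_BijGroup, of X V M] subgroup.subset[of M "perm_group V X"]
  unfolding perm_group_def by auto

lemma transl_bij: "bij (transl u v)"
  by (simp add: transl_aff bij_aff)

lemma transl_comp: "transl u v \<circ> transl u' v' = transl (u + u') (v + v')"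
  by (auto simp: transl_def fun_eq_iff)

lemma transl_0: "transl 0 0 = id"
  by (auto simp: transl_def fun_eq_iff)

lemma subgroup_translations:
  fixes W :: "('p::prime_card mod_ring \<times> 'p mod_ring) set"
  assumes "(0, 0) \<in> W" "\<And>u v u' v'. (u, v) \<in> W \<Longrightarrow> (u', v') \<in> W \<Longrightarrow> (u + u', v + v') \<in> W"
    "\<And>u v. (u, v) \<in> W \<Longrightarrow> (- u, - v) \<in> W"
  shows "subgroup {transl u v | u v. (u, v) \<in> W} (BijGroup UNIV)"
proof (rule subgroup_BijGroup_UNIV_I)
  show "id \<in> {transl u v | u v. (u, v) \<in> W}"
    using assms(1) transl_0 by (metis (mono_tags, lifting) mem_Collect_eq)
next
  fix g h :: "'p vert \<Rightarrow> 'p vert" assume "g \<in> {transl u v | u v. (u, v) \<in> W}" "h \<in> {transl u v | u v. (u, v) \<in> W}"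
  then show "g \<circ> h \<in> {transl u v | u v. (u, v) \<in> W}"
    using assms(2) by (auto simp: transl_comp) blast
next
  fix g :: "'p vert \<Rightarrow> 'p vert" assume "g \<in> {transl u v | u v. (u, v) \<in> W}"
  then obtain u v where "(u, v) \<in> W" "g = transl u v"
    by auto
  then show "\<exists>h\<in>{transl u v | u v. (u, v) \<in> W}. h \<circ> g = id"
    using assms(3) by (intro bexI[of _ "transl (- u) (- v)"]) (auto simp: transl_comp transl_0)
qed (auto simp: transl_bij)

section \<open>Primitive cube roots of unity\<close>

text \<open>Over a prime field a scalar multiple is a repeated sum, so closure under addition
  already gives closure under scaling.\<close>

lemma add_subgroup_scale:
  fixes W :: "('p::prime_card mod_ring \<times> 'p mod_ring) set"
  assumes add: "\<And>u v u' v'. (u, v) \<in> W \<Longrightarrow> (u', v') \<in> W \<Longrightarrow> (u + u', v + v') \<in> W"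
    and "(u, v) \<in> W"
  shows "(c * u, c * v) \<in> W"
proof -
  have *: "(of_nat (Suc n) * u, of_nat (Suc n) * v) \<in> W" for n
  proof (induction n)
    case (Suc n)
    then have "(u + of_nat (Suc n) * u, v + of_nat (Suc n) * v) \<in> W"
      using add assms(2) by blast
    then show ?case
      by (simp add: algebra_simps)
  qed (use assms(2) in simp)
  obtain i where i: "c = of_nat i"
    using surj_of_nat_mod_ring by blast
  \<comment> \<open>\<open>W\<close> is not assumed to contain 0, so only positive multiples are
    available; adding \<open>CARD('p)\<close> makes the representative of \<open>c\<close>
    positive.\<close>
  obtain n where n: "CARD('p) = Suc n"
    using not0_implies_Suc[of "CARD('p)"] by auto
  have "c = of_nat (i + CARD('p))"
    by (simp add: i)
  also have "\<dots> = of_nat (Suc (i + n))"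
    by (simp only: n add_Suc_right)
  finally show ?thesis
    using * by metis
qed

text \<open>If 2 = 0 then the field has only the elements 0 and 1, and neither is a cube root of
  unity other than 1.\<close>

lemma two_neq_0_if_cube_root:
  assumes "a ^ 3 = (1 :: 'p::prime_card mod_ring)" "a \<noteq> 1"
  shows "(2 :: 'p mod_ring) \<noteq> 0"
proof
  assume "(2 :: 'p mod_ring) = 0"
  then have "CARD('p) dvd 2"
    using of_nat_0_mod_ring_dvd[where 'a = 'p, of 2] by simp
  then have "CARD('p) \<le> 2"
    by (auto dest: dvd_imp_le)
  moreover obtain i where "i < CARD('p)" "a = of_nat i"
    using surj_of_nat_mod_ring by blast
  ultimately have "i = 0 \<or> i = 1" "a = of_nat i"
    by auto
  then have "a = 0 \<or> a = 1"
    by auto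
  then show False
    using assms by auto
qed

locale cube_root =
  fixes a :: "'p::prime_card mod_ring"
  assumes order_three: "has_mult_order a 3"
begin

lemma a_cube: "a ^ 3 = 1"
  and a_neq_1 [simp]: "a \<noteq> 1"
  and a2_neq_1 [simp]: "a\<^sup>2 \<noteq> 1"
  using order_three power_one_right[of a] unfolding has_mult_order_def by (auto dest: spec[of _ 1])

lemma a_neq_0 [simp]: "a \<noteq> 0"
  using a_cube by auto

lemma a_neq_a2 [simp]: "a \<noteq> a\<^sup>2" "a\<^sup>2 \<noteq> a"
  using a_neq_1 a_neq_0 by (auto simp: power2_eq_square)

lemma two_neq_0 [simp]: "(2 :: 'p mod_ring) \<noteq> 0"
  using two_neq_0_if_cube_root a_cube a_neq_1 by blast

lemma sg_eq_1_iff [simp]: "(sg d :: 'p mod_ring) = 1 \<longleftrightarrow> d = 0"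
  using two_neq_0 by (cases d) (auto simp: sg_def eq_neg_iff_add_eq_0 neg_eq_iff_add_eq_0)

lemma root_sum:
  fixes r :: "'p mod_ring"
  assumes "r ^ 3 = 1" "r \<noteq> 1"
  shows "1 + r + r\<^sup>2 = 0"
proof -
  have "(r - 1) * (1 + r + r\<^sup>2) = r ^ 3 - 1"
    by (simp add: eval_nat_numeral algebra_simps)
  then show ?thesis
    using assms by simp
qed

text \<open>In characteristic 3 the polynomial \<open>1 + a + a\<^sup>2\<close> is
  \<open>(a - 1)\<^sup>2\<close>, so its vanishing would force \<open>a = 1\<close>.\<close>

lemma three_neq_0 [simp]: "(3 :: 'p mod_ring) \<noteq> 0"
proof
  assume *: "(3 :: 'p mod_ring) = 0"
  have "(a - 1)\<^sup>2 = 1 + a + a\<^sup>2 - 3 * a"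
    by (simp add: power2_eq_square algebra_simps)
  then show False
    using root_sum[OF a_cube a_neq_1] * by simp
qed

lemma cube_roots: "r ^ 3 = 1 \<longleftrightarrow> r = 1 \<or> r = a \<or> r = a\<^sup>2" for r :: "'p mod_ring"
proof -
  have "(r - 1) * (r - a) * (r - a\<^sup>2) = r ^ 3 - (1 + a + a\<^sup>2) * r\<^sup>2 + a * (1 + a + a\<^sup>2) * r - a ^ 3"
    by (simp add: eval_nat_numeral algebra_simps)
  also have "\<dots> = r ^ 3 - 1"
    using root_sum[OF a_cube a_neq_1] by (simp add: a_cube)
  finally show ?thesis
    by (metis divisors_zero eq_iff_diff_eq_0 mult_eq_0_iff)
qed

text \<open>The affine functional \<open>(X, Y) \<mapsto> 1 + j\<^sup>2 X + j Y\<close> picks out the root \<open>j\<close> among the three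
  neighbour offsets \<open>(q, q\<^sup>2)\<close>.\<close>

lemma separation:
  fixes j q :: "'p mod_ring"
  assumes "j ^ 3 = 1" "q ^ 3 = 1"
  shows "1 + j\<^sup>2 * q + j * q\<^sup>2 = (if q = j then 3 else 0)"
proof (cases "q = j")
  case True
  then show ?thesis
    using assms by (simp add: eval_nat_numeral mult.assoc)
next
  case False
  \<comment> \<open>\<open>w\<close> is the quotient of \<open>q\<close> by \<open>j\<close>; the
    functional becomes \<open>1 + w + w\<^sup>2\<close>, which vanishes for a cube root other than
    1.\<close>
  define w where "w = j\<^sup>2 * q"
  have "w ^ 3 = 1"
    unfolding w_def using assms by (intro cube_mult cube_square)
  moreover have "w \<noteq> 1"
    using False cube_inverse(2)[OF assms(1)] assms(1) unfolding w_def
    by (metis mult.assoc mult.commute mult.right_neutral)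
  moreover have "w\<^sup>2 = j * q\<^sup>2"
    unfolding w_def using assms(1) by (simp add: eval_nat_numeral mult.assoc mult.left_commute)
  ultimately show ?thesis
    using root_sum[of w] False by (simp add: w_def add.assoc)
qed

text \<open>The eigenlines of \<^term>\<open>tau a\<close> are the coordinate axes, and \<^const>\<open>sigma\<close> swaps them: hence
  \<open>\<int>\<^sub>p\<^sup>2\<close> is an irreducible module.\<close>

lemma irreducible:
  fixes W :: "('p mod_ring \<times> 'p mod_ring) set"
  assumes add: "\<And>u v u' v'. (u, v) \<in> W \<Longrightarrow> (u', v') \<in> W \<Longrightarrow> (u + u', v + v') \<in> W"
    and diag: "\<And>u v. (u, v) \<in> W \<Longrightarrow> (a * u, a\<^sup>2 * v) \<in> W"
    and swap: "\<And>u v. (u, v) \<in> W \<Longrightarrow> (k * v, k * u) \<in> W"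
    and nz: "k \<noteq> 0" "(u, v) \<in> W" "(u, v) \<noteq> (0, 0)"
  shows "W = UNIV"
proof -
  have scale: "(c * u, c * v) \<in> W" if "(u, v) \<in> W" for c u v
    using add_subgroup_scale[of W] add that by blast
  obtain w where w: "w \<noteq> 0" "(0, w) \<in> W"
  proof (cases "v = 0")
    case True
    then show ?thesis
      using that[of "k * u"] swap[OF nz(2)] nz by auto
  next
    case False
    \<comment> \<open>Subtracting \<open>a\<close> times the vector from its diagonal image kills
      the first coordinate and multiplies the second by \<open>a\<^sup>2 - a\<close>, which is
      nonzero.\<close>
    have "(a * u + (- a) * u, a\<^sup>2 * v + (- a) * v) \<in> W"
      using add[OF diag[OF nz(2)] scale[OF nz(2)]] .
    then have "(0, (a\<^sup>2 - a) * v) \<in> W"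
      by (simp add: algebra_simps)
    then show ?thesis
      using that[of "(a\<^sup>2 - a) * v"] False by simp
  qed
  have 1: "(0, z) \<in> W" for z
    using scale[OF w(2), of "z / w"] w(1) by simp
  have 2: "(z, 0) \<in> W" for z
    using swap[OF 1[of "z / k"]] nz(1) by simp
  show ?thesis
    using add[OF 2 1] by auto
qed

end

section \<open>Transitivity and orbits\<close>

lemma group_hom_perm:
  assumes "subgroup X (BijGroup V)"
  shows "group_hom (perm_group V X) (BijGroup V) (\<lambda>g. g)"
  using group_perm_group[OF assms] group_BijGroup subgroup.subset[OF assms]
  by (auto simp: group_hom_def group_hom_axioms_def hom_def)

lemma transitive_perm_iff:
  assumes "subgroup X (BijGroup V)"
  shows "transitive_perm V X \<longleftrightarrow> (\<forall>x\<in>V. \<forall>y\<in>V. \<exists>g\<in>X. g x = y)"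
  using group_hom_perm[OF assms]
  by (auto simp: transitive_perm_def transitive_action_def transitive_action_axioms_def group_action_def)

lemma perm_orbits_eq: "perm_orbits V X = (\<lambda>x. (\<lambda>g. g x) ` X) ` V"
  by (auto simp: perm_orbits_def orbits_def orbit_def)

text \<open>Restates normality with plain composition and a one-sided inverse, the form in which
  inverses of affine maps are at hand.\<close>

lemma normal_perm_group_UNIV:
  assumes "M \<lhd> perm_group UNIV X" "subgroup X (BijGroup UNIV)"
  shows "subgroup M (BijGroup UNIV)" "M \<subseteq> X"
    "\<And>g h. g \<in> M \<Longrightarrow> h \<in> M \<Longrightarrow> g \<circ> h \<in> M"
    "\<And>g h. g \<in> M \<Longrightarrow> h \<circ> g = id \<Longrightarrow> h \<in> M"
    "\<And>m g h. m \<in> M \<Longrightarrow> g \<in> X \<Longrightarrow> h \<circ> g = id \<Longrightarrow> g \<circ> m \<circ> h \<in> M"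
proof -
  have s: "subgroup M (BijGroup UNIV)" "M \<subseteq> X"
    using normal_imp_subgroup[OF assms(1)] subgroup_perm_group[OF assms(2)] by blast+
  then show "subgroup M (BijGroup UNIV)" "M \<subseteq> X"
    by auto
  have b: "bij g" if "g \<in> X" for g
    using subgroup.subset[OF assms(2)] that by auto
  fix g h 
  show "g \<in> M \<Longrightarrow> h \<in> M \<Longrightarrow> g \<circ> h \<in> M"
    using subgroup.m_closed[OF s(1)] s(2) b by (metis mult_BijGroup_UNIV subsetD)
  show "g \<in> M \<Longrightarrow> h \<circ> g = id \<Longrightarrow> h \<in> M"
    using subgroup.m_inv_closed[OF s(1)] s(2) b by (metis inv_BijGroup_UNIV subsetD)
  fix m assume *: "m \<in> M" "g \<in> X" "h \<circ> g = id"
  then have "inv\<^bsub>perm_group UNIV X\<^esub> g = h"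
    using inv_BijGroup_UNIV[OF b] by (simp add: inv_perm_group[OF assms(2)])
  moreover have "bij h"
    using * b inv_BijGroup_UNIV[OF b] subgroup.m_inv_closed[OF assms(2)] by metis
  ultimately show "g \<circ> m \<circ> h \<in> M"
    using normal.inv_op_closed2[OF assms(1), of g m] * b s(2)
    by (auto simp: mult_BijGroup_UNIV bij_comp subset_iff)
qed

lemma normal_perm_group_UNIV_I:
  assumes "subgroup X (BijGroup UNIV)" "subgroup M (BijGroup UNIV)" "M \<subseteq> X"
    "\<And>m g h. m \<in> M \<Longrightarrow> g \<in> X \<Longrightarrow> h \<in> X \<Longrightarrow> h \<circ> g = id \<Longrightarrow> g \<circ> h = id \<Longrightarrow> g \<circ> m \<circ> h \<in> M"
  shows "M \<lhd> perm_group UNIV X"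
proof (rule group.normal_invI[OF group_perm_group[OF assms(1)]])
  show "subgroup M (perm_group UNIV X)"
    using assms subgroup_perm_group by blast
  fix g m assume g: "g \<in> carrier (perm_group UNIV X)" and m: "m \<in> M"
  have b: "bij g" if "g \<in> X" for g
    using subgroup.subset[OF assms(1)] that by auto
  define h where "h = inv\<^bsub>BijGroup UNIV\<^esub> g"
  have h: "h \<in> X"
    unfolding h_def using g subgroup.m_inv_closed[OF assms(1)] by simp
  have "h \<circ> g = id" "g \<circ> h = id"
    using group.l_inv[OF group_BijGroup, of g UNIV] group.r_inv[OF group_BijGroup, of g UNIV] g h b
    by (simp_all add: mult_BijGroup_UNIV flip: h_def)
  then have "g \<circ> m \<circ> h \<in> M"
    using assms(4) g h m by auto
  then show "g \<otimes>\<^bsub>perm_group UNIV X\<^esub> m \<otimes>\<^bsub>perm_group UNIV X\<^esub> inv\<^bsub>perm_group UNIV X\<^esub> g \<in> M"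
    using g h m b assms(3)
    by (auto simp: mult_BijGroup_UNIV inv_perm_group[OF assms(1)] bij_comp subset_iff simp flip: h_def)
qed

section \<open>The induced group on an invariant subset\<close>

locale invariant_subset =
  fixes X :: "('v \<Rightarrow> 'v) set" and B :: "'v set"
  assumes subgroup_X: "subgroup X (BijGroup UNIV)"
    and invariant: "\<And>g. g \<in> X \<Longrightarrow> g ` B = B"
begin

lemma bij_X: "g \<in> X \<Longrightarrow> bij g"
  using subgroup.subset[OF subgroup_X] by auto

lemma restrict_Bij: "g \<in> X \<Longrightarrow> restrict g B \<in> Bij B"
  using bij_X invariant by (auto simp: Bij_def bij_betw_def inj_on_def bij_def)

lemma group_hom_restrict: "group_hom (perm_group UNIV X) (BijGroup B) (\<lambda>g. restrict g B)"
proof -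
  have "restrict (g \<circ> h) B = compose B (restrict g B) (restrict h B)" if "g \<in> X" "h \<in> X" for g h
    using invariant[OF that(2)] by (auto simp: compose_def fun_eq_iff)
  then show ?thesis
    using group_perm_group[OF subgroup_X] group_BijGroup
    by (auto simp: group_hom_def group_hom_axioms_def hom_def restrict_Bij mult_BijGroup[of _ B] bij_X mult_BijGroup_UNIV)
qed

lemma subgroup_induced: "subgroup (induced X B) (BijGroup B)"
  using group_hom.img_is_subgroup[OF group_hom_restrict] by (simp add: induced_def)

lemma group_hom_induced: "group_hom (perm_group UNIV X) (perm_group B (induced X B)) (\<lambda>g. restrict g B)"
  using group_hom_restrict group_perm_group[OF subgroup_induced]
  by (auto simp: group_hom_def group_hom_axioms_def hom_def induced_def)

text \<open>Carries normal subgroups of the induced group back to \<open>X\<close>, where the normal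
  subgroups are understood; the kernel of the restriction never has to be determined.\<close>

lemma normal_preimage:
  assumes "M \<lhd> perm_group B (induced X B)"
  shows "{g \<in> X. restrict g B \<in> M} \<lhd> perm_group UNIV X"
proof -
  interpret group_hom "perm_group UNIV X" "perm_group B (induced X B)" "\<lambda>g. restrict g B"
    by (rule group_hom_induced)
  interpret M: normal M "perm_group B (induced X B)"
    by (rule assms)
  have mem: "restrict g B \<in> induced X B" if "g \<in> X" for g
    using that by (auto simp: induced_def)
  show ?thesis
  proof (rule G.normal_invI)
    show "subgroup {g \<in> X. restrict g B \<in> M} (perm_group UNIV X)"
    proof (rule G.subgroupI)
      show "{g \<in> X. restrict g B \<in> M} \<noteq> {}"
        using G.one_closed hom_one M.one_closed by auto
    next
      fix g assume "g \<in> {g \<in> X. restrict g B \<in> M}"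
      then show "inv\<^bsub>perm_group UNIV X\<^esub> g \<in> {g \<in> X. restrict g B \<in> M}"
        using G.inv_closed[of g] hom_inv[of g] M.m_inv_closed by auto
    next
      fix g h assume "g \<in> {g \<in> X. restrict g B \<in> M}" "h \<in> {g \<in> X. restrict g B \<in> M}"
      then show "g \<otimes>\<^bsub>perm_group UNIV X\<^esub> h \<in> {g \<in> X. restrict g B \<in> M}"
        using G.m_closed[of g h] hom_mult[of g h] M.m_closed by auto
    qed auto
  next
    fix g m assume *: "g \<in> carrier (perm_group UNIV X)" "m \<in> {g \<in> X. restrict g B \<in> M}"
    then have "restrict (g \<otimes>\<^bsub>perm_group UNIV X\<^esub> m \<otimes>\<^bsub>perm_group UNIV X\<^esub> inv\<^bsub>perm_group UNIV X\<^esub> g) B =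
      restrict g B \<otimes>\<^bsub>perm_group B (induced X B)\<^esub> restrict m B
        \<otimes>\<^bsub>perm_group B (induced X B)\<^esub> inv\<^bsub>perm_group B (induced X B)\<^esub> restrict g B"
      using G.inv_closed[of g] G.m_closed[of g m] by (simp only: hom_mult hom_inv carrier_perm_group mem_Collect_eq)
    moreover have "\<dots> \<in> M"
      using * mem by (intro M.inv_op_closed2) auto
    ultimately show "g \<otimes>\<^bsub>perm_group UNIV X\<^esub> m \<otimes>\<^bsub>perm_group UNIV X\<^esub> inv\<^bsub>perm_group UNIV X\<^esub> g \<in> {g \<in> X. restrict g B \<in> M}"
      using * G.inv_closed[of g] G.m_closed[of g m] G.m_closed[of "g \<otimes>\<^bsub>perm_group UNIV X\<^esub> m" "inv\<^bsub>perm_group UNIV X\<^esub> g"]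
      by (simp del: mult_perm_group)
  qed
qed

lemma normal_image:
  assumes "M \<lhd> perm_group UNIV X"
  shows "(\<lambda>g. restrict g B) ` M \<lhd> perm_group B (induced X B)"
  using normal.surj_hom_normal_subgroup[OF assms group_hom_induced] by (simp add: induced_def)

end

section \<open>Normal subgroups\<close>

definition plus_types :: "(bool \<times> bit) set \<Rightarrow> (bool \<times> bit) set" where
  "plus_types C = {(s, d) \<in> C. d = 0}"

lemma type_subgroup_plus: "type_subgroup C \<Longrightarrow> type_subgroup (plus_types C)"
  unfolding type_subgroup_def plus_types_def by fastforce

lemma transl_in_N: "transl u v \<in> N_group"
  by (auto simp: N_group_def)

lemma subgroup_N: "subgroup N_group (BijGroup UNIV)"
  using subgroup_translations[of UNIV] by (simp add: N_group_def)

lemma N_subset_Aff: "type_subgroup C \<Longrightarrow> N_group \<subseteq> Aff C"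
  by (auto simp: N_group_def transl_aff type_subgroup_def intro: aff_in_Aff)

lemma aff_third [simp]: "snd (snd (aff r s d u v w)) = snd (snd w) + d"
  by (auto simp: aff_def split: prod.splits)

text \<open>Moving a translation past an affine map applies the linear part to its vector.\<close>

lemma conj_transl:
  assumes "aff r s d u v \<circ> h = id"
  shows "aff r s d u v \<circ> transl p q \<circ> h =
    transl (sg d * r * (if s then q else p)) (sg d * r\<^sup>2 * (if s then p else q))"
proof -
  have "aff r s d u v \<circ> transl p q =
      transl (sg d * r * (if s then q else p)) (sg d * r\<^sup>2 * (if s then p else q)) \<circ> aff r s d u v"
    by (auto simp: aff_def transl_def fun_eq_iff algebra_simps)
  then show ?thesis
    using assms by (metis comp_assoc comp_id)
qed

text \<open>Conjugation acts on translations through linear parts only, so a group of vectors stable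
  under these parts gives a normal subgroup.\<close>

lemma normal_translations:
  assumes C: "type_subgroup C" and "(0, 0) \<in> W"
    and "\<And>u v u' v'. (u, v) \<in> W \<Longrightarrow> (u', v') \<in> W \<Longrightarrow> (u + u', v + v') \<in> W"
    and "\<And>u v. (u, v) \<in> W \<Longrightarrow> (- u, - v) \<in> W"
    and invariant: "\<And>r s d u v. r ^ 3 = 1 \<Longrightarrow> (s, d) \<in> C \<Longrightarrow> (u, v) \<in> W \<Longrightarrow>
        (sg d * r * (if s then v else u), sg d * r\<^sup>2 * (if s then u else v)) \<in> W"
  shows "{transl u v | u v. (u, v) \<in> W} \<lhd> perm_group UNIV (Aff C :: ('p::prime_card vert \<Rightarrow> 'p vert) set)"
proof (rule normal_perm_group_UNIV_I[OF subgroup_Aff[OF C] subgroup_translations])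
  show "{transl u v | u v. (u, v) \<in> W} \<subseteq> Aff C"
    using N_subset_Aff[OF C] by (auto simp: N_group_def)
next
  fix m g h :: "'p vert \<Rightarrow> 'p vert"
  assume *: "m \<in> {transl u v | u v. (u, v) \<in> W}" "g \<in> Aff C" "g \<circ> h = id"
  obtain p q where m: "m = transl p q" "(p, q) \<in> W"
    using *(1) by auto
  obtain r s d u v where g: "g = aff r s d u v" "r ^ 3 = 1" "(s, d) \<in> C"
    using *(2) by (elim AffE)
  show "g \<circ> m \<circ> h \<in> {transl u v | u v. (u, v) \<in> W}"
    using conj_transl[of r s d u v h p q] invariant[OF g(2,3) m(2)] *(3) unfolding m g by blast
qed (use assms in auto)

lemma normal_N: "type_subgroup C \<Longrightarrow> N_group \<lhd> perm_group UNIV (Aff C)"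
  using normal_translations[of C UNIV] by (simp add: N_group_def)

context cube_root
begin

text \<open>The commutator of \<open>g\<close> with a translation lies in \<open>M\<close> by
  normality, and is itself a translation because \<open>N_group\<close> is normal. If all these
  commutators are trivial, then \<open>g\<close> has trivial linear part and is itself a
  translation.\<close>

lemma exists_translation:
  fixes M :: "('p vert \<Rightarrow> 'p vert) set"
  assumes C: "type_subgroup C"
    and M: "M \<lhd> perm_group UNIV (Aff C)" "g \<in> M" "g \<noteq> id"
  obtains p q :: "'p mod_ring" where "transl p q \<in> M" "(p, q) \<noteq> (0, 0)"
proof -
  note M' = normal_perm_group_UNIV[OF M(1) subgroup_Aff[OF C]]
  obtain r s d u v where g: "g = aff r s d u v" "r ^ 3 = 1" "(s, d) \<in> C"
    using subsetD[OF M'(2) M(2)] by (elim AffE)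
  obtain h where h: "h \<circ> g = id" "g \<circ> h = id"
    using aff_inverse g by metis
  define p where "p x y = x - sg d * r * (if s then y else x)" for x y
  define q where "q x y = y - sg d * r\<^sup>2 * (if s then x else y)" for x y
  have com: "transl (p x y) (q x y) \<in> M" for x y
  proof -
    have "transl x y \<in> Aff C"
      using N_subset_Aff[OF C] transl_in_N by blast
    moreover have "transl (- x) (- y) \<circ> transl x y = id"
      by (simp add: transl_comp transl_0)
    ultimately have "(transl x y \<circ> g \<circ> transl (- x) (- y)) \<circ> h \<in> M"
      using M'(3-5) M(2) h by blast
    also have "(transl x y \<circ> g \<circ> transl (- x) (- y)) \<circ> h = transl x y \<circ> (g \<circ> transl (- x) (- y) \<circ> h)"
      by (simp add: comp_assoc)
    also have "\<dots> = transl (p x y) (q x y)"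
      using conj_transl[of r s d u v h "- x" "- y"] h(2)
      unfolding g p_def q_def by (cases s) (simp_all add: transl_comp)
    finally show ?thesis .
  qed
  show ?thesis
  proof (cases "\<exists>x y. (p x y, q x y) \<noteq> (0, 0)")
    case True
    then show ?thesis
      using com that by blast
  next
    case False
    then have "p 1 0 = 0" "q 1 0 = 0" "p 0 1 = 0" "q 0 1 = 0"
      by auto
    \<comment> \<open>The linear part of \<open>g\<close> fixes both unit vectors. Dividing the two
      equations gives \<open>r = 1\<close>, and then \<open>d = 0\<close> because 1 and -1
      differ.\<close>
    then have "\<not> s" "sg d * r = 1" "sg d * r\<^sup>2 = 1"
      by (auto simp: p_def q_def split: if_splits)
    then have "\<not> s" "r = 1" "d = 0"
      by (metis mult.assoc mult.left_neutral power2_eq_square mult.right_neutral sg_eq_1_iff)+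
    then have "g = transl u v"
      by (simp add: g transl_aff)
    then show ?thesis
      using that M(2,3) transl_0 by auto
  qed
qed

lemma N_subset_normal:
  fixes M :: "('p vert \<Rightarrow> 'p vert) set"
  assumes C: "type_subgroup C" "(True, d) \<in> C"
    and M: "M \<lhd> perm_group UNIV (Aff C)" "g \<in> M" "g \<noteq> id"
  shows "(N_group :: ('p vert \<Rightarrow> 'p vert) set) \<subseteq> M"
proof -
  note M' = normal_perm_group_UNIV[OF M(1) subgroup_Aff[OF C(1)]]
  obtain p q :: "'p mod_ring" where pq: "transl p q \<in> M" "(p, q) \<noteq> (0, 0)"
    using exists_translation[OF C(1) M] .
  have conj: "transl (sg d * r * (if s then v else u)) (sg d * r\<^sup>2 * (if s then u else v)) \<in> M"
    if t: "transl u v \<in> M" "r ^ 3 = 1" "(s, d) \<in> C" for u v r s d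
  proof -
    obtain h where "h \<circ> aff r s d 0 0 = id" "aff r s d 0 0 \<circ> h = id"
      using aff_inverse[OF t(2)] by metis
    then show ?thesis
      using M'(5)[OF t(1) aff_in_Aff[OF t(2,3)], of h 0 0] conj_transl[of r s d 0 0 h u v] by simp
  qed
  \<comment> \<open>The available swap may carry a sign, as \<open>sigma \<circ> nu\<close> does;
    this is the factor \<open>k\<close> in \<open>irreducible\<close>.\<close>
  have "{(u, v). transl u v \<in> M} = UNIV"
  proof (rule irreducible[where k = "sg d" and u = p and v = q])
    fix u v assume "(u, v) \<in> {(u, v). transl u v \<in> M}"
    then show "(a * u, a\<^sup>2 * v) \<in> {(u, v). transl u v \<in> M}"
      using conj[of u v a False 0] C(1) a_cube by (simp add: type_subgroup_def)
  next
    fix u v assume "(u, v) \<in> {(u, v). transl u v \<in> M}"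
    then show "(sg d * v, sg d * u) \<in> {(u, v). transl u v \<in> M}"
      using conj[of u v 1 True d] C(2) by simp
  next
    fix u v u' v' assume "(u, v) \<in> {(u, v). transl u v \<in> M}" "(u', v') \<in> {(u, v). transl u v \<in> M}"
    then show "(u + u', v + v') \<in> {(u, v). transl u v \<in> M}"
      using M'(3) transl_comp by (metis case_prodD case_prodI mem_Collect_eq)
  qed (use pq in auto)
  then show ?thesis
    by (auto simp: N_group_def)
qed

end

section \<open>Quasiprimitivity\<close>

lemma half_eq: "half e = {w. snd (snd w) = e}"
  by (auto simp: half_def)

lemma transl_transitive:
  assumes "snd (snd w) = snd (snd w')"
  obtains u v where "transl u v w = w'"
proof
  show "transl (fst w' - fst w) (fst (snd w') - fst (snd w)) w = w'"
    using assms by (cases w; cases w') (auto simp: transl_def)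
qed

text \<open>\<open>N_group\<close> is transitive on each half, so the orbit of a vertex depends only
  on its half. The two listed orbits may coincide.\<close>

lemma orbits_N_subset:
  assumes M: "subgroup M (BijGroup UNIV)" and "N_group \<subseteq> M"
  shows "perm_orbits UNIV (M :: ('p::prime_card vert \<Rightarrow> 'p vert) set) \<subseteq>
    {(\<lambda>g. g (0, 0, 0)) ` M, (\<lambda>g. g (0, 0, 1)) ` M}"
proof -
  have orb: "(\<lambda>g. g w) ` M = (\<lambda>g. g (0, 0, snd (snd w))) ` M" (is "?l = ?r") for w :: "'p vert"
  proof -
    have comp: "g \<circ> h \<in> M" if "g \<in> M" "h \<in> M" for g h
      using subgroup.m_closed[OF M that] subgroup.subset[OF M] that by (auto simp: mult_BijGroup_UNIV subset_iff)
    obtain u v u' v' where t: "transl u v w = (0, 0, snd (snd w))" "transl u' v' (0, 0, snd (snd w)) = w"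
      by (metis transl_transitive snd_conv)
    have tM: "transl u v \<in> M" for u v
      using assms(2) transl_in_N by blast
    have "g w \<in> ?r" if "g \<in> M" for g
      using comp[OF that tM[of u' v']] t(2) by (intro image_eqI[where x = "g \<circ> transl u' v'"]) simp_all
    moreover have "g (0, 0, snd (snd w)) \<in> ?l" if "g \<in> M" for g
      using comp[OF that tM[of u v]] t(1) by (intro image_eqI[where x = "g \<circ> transl u v"]) simp_all
    ultimately show ?thesis
      by blast
  qed
  have "(\<lambda>g. g w) ` M \<in> {(\<lambda>g. g (0, 0, 0)) ` M, (\<lambda>g. g (0, 0, 1)) ` M}" for w :: "'p vert"
    using orb[of w] by (cases "snd (snd w)") simp_all
  then show ?thesis
    unfolding perm_orbits_eq by blast
qed

lemma transl_1_neq_id: "transl 1 v \<noteq> id"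
proof
  assume "transl 1 v = id"
  then have "transl 1 v (0, 0, 0) = (0, 0, 0)"
    by simp
  then show False
    by (simp add: transl_def)
qed

text \<open>A type \<open>(s, 1)\<close> joins the halves, giving transitivity;
  \<open>N_group\<close> is a normal subgroup that preserves them, so quasiprimitivity fails; and by
  the type \<open>(True, d)\<close> every nontrivial normal subgroup contains
  \<open>N_group\<close>, hence has at most two orbits.\<close>

lemma (in cube_root) biquasiprimitive_Aff:
  assumes C: "type_subgroup C" "(True, d) \<in> C" "(s, 1) \<in> C"
  shows "biquasiprimitive UNIV (Aff C :: ('p vert \<Rightarrow> 'p vert) set)"
  unfolding biquasiprimitive_def
proof (intro conjI allI impI)
  have "\<exists>g\<in>Aff C. g w = w'" for w w' :: "'p vert"
  proof (cases "snd (snd w) = snd (snd w')")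
    case True
    then show ?thesis
      using transl_transitive N_subset_Aff[OF C(1)] transl_in_N by (metis subsetD)
  next
    case False
    then have "snd (snd (aff 1 s 1 0 0 w)) = snd (snd w')"
      by (cases "snd (snd w)"; cases "snd (snd w')") auto
    then obtain u v where "transl u v (aff 1 s 1 0 0 w) = w'"
      using transl_transitive by blast
    then have "aff 1 s 1 u v w = w'"
      by (cases w) (simp add: aff_def transl_def)
    then show ?thesis
      using C(3) aff_in_Aff[of 1 s 1 C u v] by auto
  qed
  then show "transitive_perm UNIV (Aff C :: ('p vert \<Rightarrow> 'p vert) set)"
    using transitive_perm_iff[OF subgroup_Aff[OF C(1)]] by blast
next
  have "nontrivial_normal UNIV (Aff C) (N_group :: ('p vert \<Rightarrow> 'p vert) set)"
    using normal_N[OF C(1)] transl_in_N[of 1 0] transl_1_neq_id by (auto simp: nontrivial_normal_def)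
  moreover have "\<not> transitive_perm UNIV (N_group :: ('p vert \<Rightarrow> 'p vert) set)"
  proof
    assume "transitive_perm UNIV (N_group :: ('p vert \<Rightarrow> 'p vert) set)"
    then obtain g :: "'p vert \<Rightarrow> 'p vert" where "g \<in> N_group" "g (0, 0, 0) = (0, 0, 1)"
      using transitive_perm_iff[OF subgroup_N] by blast
    then show False
      by (auto simp: N_group_def transl_def)
  qed
  ultimately show "\<not> quasiprimitive UNIV (Aff C :: ('p vert \<Rightarrow> 'p vert) set)"
    by (auto simp: quasiprimitive_def)
next
  fix M :: "('p vert \<Rightarrow> 'p vert) set" assume "nontrivial_normal UNIV (Aff C) M"
  then have M: "M \<lhd> perm_group UNIV (Aff C)" "M \<noteq> {id}"
    by (auto simp: nontrivial_normal_def)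
  note M' = normal_perm_group_UNIV(1)[OF M(1) subgroup_Aff[OF C(1)]]
  obtain g where "g \<in> M" "g \<noteq> id"
    using M(2) subgroup.one_closed[OF M'] by auto
  then have "N_group \<subseteq> M"
    using N_subset_normal C M by blast
  then obtain O1 O2 where *: "perm_orbits UNIV M \<subseteq> {O1, O2}"
    using orbits_N_subset[OF M'] by meson
  then show "finite (perm_orbits UNIV M)"
    by (rule finite_subset) simp
  have "card {O1, O2} \<le> 2"
    by (simp add: card_insert_if)
  then show "card (perm_orbits UNIV M) \<le> 2"
    using card_mono[OF _ *] by simp
qed

text \<open>A map with a fixed vertex cannot exchange the halves. Conversely, every map preserving
  the halves is a product of two maps that each fix a vertex.\<close>

lemma (in cube_root) plus_subgroup_Aff:
  assumes C: "type_subgroup C"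
  shows "plus_subgroup UNIV (Aff C) = (Aff (plus_types C) :: ('p vert \<Rightarrow> 'p vert) set)"
proof -
  define S :: "('p vert \<Rightarrow> 'p vert) set" where
    "S = (\<Union>w\<in>UNIV. stabilizer (perm_group UNIV (Aff C)) (\<lambda>g. g) w)"
  have S: "g \<in> S \<longleftrightarrow> g \<in> Aff C \<and> (\<exists>w. g w = w)" for g
    by (auto simp: S_def stabilizer_def)
  have "S \<subseteq> Aff (plus_types C)"
  proof
    fix g assume "g \<in> S"
    then obtain r s d u v w where g: "g = aff r s d u v" "r ^ 3 = 1" "(s, d) \<in> C" "g w = w"
      unfolding S by (auto elim: AffE)
    then have "snd (snd w) + d = snd (snd w)"
      by (metis aff_third)
    then show "g \<in> Aff (plus_types C)"
      using g by (auto simp: plus_types_def intro: aff_in_Aff)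
  qed
  then have "generate (BijGroup UNIV) S \<subseteq> Aff (plus_types C)"
    using group.generate_subgroup_incl[OF group_BijGroup] subgroup_Aff[OF type_subgroup_plus[OF C]] by blast
  moreover have "Aff (plus_types C) \<subseteq> generate (BijGroup UNIV) S"
  proof
    fix g :: "'p vert \<Rightarrow> 'p vert" assume "g \<in> Aff (plus_types C)"
    then obtain r s u v where g: "g = aff r s 0 u v" "r ^ 3 = 1" "(s, 0) \<in> C"
      by (auto simp: plus_types_def elim: AffE)
    \<comment> \<open>A nontrivial translation fixes no vertex, so the translation part is combined
      with \<open>tau a\<close>; the factor \<open>a\<^sup>2\<close> in \<open>h\<close>
      compensates, as \<open>a * a\<^sup>2 = 1\<close>.\<close>
    define h where "h = aff (a\<^sup>2 * r) s 0 0 0"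
    define t where "t = aff a False 0 u v"
    have r: "(a\<^sup>2 * r) ^ 3 = 1"
      using g a_cube by (intro cube_mult cube_square)
    have "h (0, 0, 0) = (0, 0, 0)"
      by (simp add: h_def aff_def)
    moreover have "h \<in> Aff C"
      unfolding h_def using g(3) r by (intro aff_in_Aff)
    \<comment> \<open>The point solves \<open>a * x + u = x\<close> and
      \<open>a\<^sup>2 * y + v = y\<close>, which is possible since neither \<open>a\<close> nor
      \<open>a\<^sup>2\<close> is 1.\<close>
    moreover have "t (u / (1 - a), v / (1 - a\<^sup>2), 0) = (u / (1 - a), v / (1 - a\<^sup>2), 0)"
      using a_neq_1 a2_neq_1 by (simp add: t_def aff_def field_simps)
    moreover have "t \<in> Aff C"
      unfolding t_def using C a_cube by (intro aff_in_Aff) (auto simp: type_subgroup_def)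
    ultimately have "h \<in> S" "t \<in> S"
      unfolding S by blast+
    then have "t \<otimes>\<^bsub>BijGroup UNIV\<^esub> h \<in> generate (BijGroup UNIV) S"
      by (intro generate.eng generate.incl)
    moreover have "t \<otimes>\<^bsub>BijGroup UNIV\<^esub> h = g"
    proof -
      have "t \<circ> h = g"
        unfolding t_def h_def aff_comp[OF r] g using cube_inverse(1)[OF a_cube] by (simp flip: mult.assoc)
      then show ?thesis
        using r a_cube by (simp add: mult_BijGroup_UNIV t_def h_def bij_aff)
    qed
    ultimately show "g \<in> generate (BijGroup UNIV) S"
      by simp
  qed
  ultimately show ?thesis
    unfolding plus_subgroup_def S_def[symmetric] by blast
qed

lemma invariant_half:
  assumes "type_subgroup C"
  shows "invariant_subset (Aff (plus_types C)) (half e :: 'p::prime_card vert set)"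
proof (rule invariant_subset.intro)
  show "subgroup (Aff (plus_types C) :: ('p vert \<Rightarrow> 'p vert) set) (BijGroup UNIV)"
    by (rule subgroup_Aff[OF type_subgroup_plus[OF assms]])
  fix g :: "'p vert \<Rightarrow> 'p vert" assume g: "g \<in> Aff (plus_types C)"
  have third: "snd (snd (g w)) = snd (snd w)" for w
    using g by (auto simp: plus_types_def elim!: AffE)
  have "w \<in> g ` half e" if "w \<in> half e" for w
  proof -
    obtain w' where "w = g w'"
      using Aff_bij[OF g] by (metis bij_pointE)
    then show ?thesis
      using third[of w'] that by (auto simp: half_eq)
  qed
  then show "g ` half e = half e"
    using third by (auto simp: half_eq)
qed

lemma orbits_plus:
  assumes "type_subgroup C"
  shows "perm_orbits UNIV (Aff (plus_types C)) = {half 0, half 1 :: 'p::prime_card vert set}"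
proof -
  have "(\<lambda>g. g w) ` Aff (plus_types C) = half (snd (snd w))" for w :: "'p vert"
  proof
    show "(\<lambda>g. g w) ` Aff (plus_types C) \<subseteq> half (snd (snd w))"
      by (auto simp: plus_types_def half_eq elim!: AffE)
    show "half (snd (snd w)) \<subseteq> (\<lambda>g. g w) ` Aff (plus_types C)"
    proof
      fix w' :: "'p vert" assume "w' \<in> half (snd (snd w))"
      then obtain u v where "transl u v w = w'"
        using transl_transitive[of w w'] by (auto simp: half_eq)
      then show "w' \<in> (\<lambda>g. g w) ` Aff (plus_types C)"
        using N_subset_Aff[OF type_subgroup_plus[OF assms]] transl_in_N by blast
    qed
  qed
  then have "perm_orbits UNIV (Aff (plus_types C)) = range (\<lambda>w :: 'p vert. half (snd (snd w)) :: 'p vert set)"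
    by (simp add: perm_orbits_eq)
  also have "\<dots> = half ` range (\<lambda>w :: 'p vert. snd (snd w))"
    by (simp only: image_image)
  also have "range (\<lambda>w :: 'p vert. snd (snd w)) = UNIV"
    by (rule surjI[of _ "\<lambda>e. (0, 0, e)"]) simp
  also have "(UNIV :: bit set) = {0, 1}"
    using bit.exhaust by blast
  also have "half ` {0, 1} = {half 0, half 1 :: 'p vert set}"
    by (simp only: image_insert image_empty)
  finally show ?thesis .
qed

text \<open>The type \<open>(True, 0)\<close> survives in \<open>plus_types C\<close>, so
  \<open>N_group\<close> lies in the preimage of every nontrivial normal subgroup of the induced
  group, and \<open>N_group\<close> is already transitive on the half.\<close>

lemma (in cube_root) quasiprimitive_on_half:
  assumes C: "type_subgroup C" "(True, 0) \<in> C"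
  shows "quasiprimitive_on (Aff (plus_types C)) (half e :: 'p vert set)"
proof -
  define X :: "('p vert \<Rightarrow> 'p vert) set" where "X = Aff (plus_types C)"
  have C': "type_subgroup (plus_types C)" "(True, 0) \<in> plus_types C"
    using type_subgroup_plus C by (auto simp: plus_types_def)
  interpret invariant_subset X "half e"
    unfolding X_def by (rule invariant_half[OF C(1)])
  have trans: "transitive_perm (half e) M"
    if "subgroup M (BijGroup (half e))" "(\<lambda>g. restrict g (half e)) ` N_group \<subseteq> M"
    for M :: "('p vert \<Rightarrow> 'p vert) set"
    unfolding transitive_perm_iff[OF that(1)]
  proof (intro ballI)
    fix w w' :: "'p vert" assume w: "w \<in> half e" "w' \<in> half e"
    then obtain u v where "transl u v w = w'"
      using transl_transitive[of w w'] by (auto simp: half_eq)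
    then show "\<exists>g\<in>M. g w = w'"
      using that(2) w transl_in_N[of u v] by (intro bexI[of _ "restrict (transl u v) (half e)"]) auto
  qed
  have "transitive_perm (half e) (induced X (half e))"
    using trans[OF subgroup_induced] N_subset_Aff[OF C'(1)] by (auto simp: induced_def X_def)
  moreover have "transitive_perm (half e) M" if M: "nontrivial_normal (half e) (induced X (half e)) M" for M
  proof -
    have normal: "M \<lhd> perm_group (half e) (induced X (half e))" and nt: "M \<noteq> {\<one>\<^bsub>BijGroup (half e)\<^esub>}"
      using M by (auto simp: nontrivial_normal_def)
    have sub: "subgroup M (BijGroup (half e))" "M \<subseteq> induced X (half e)"
      using normal_imp_subgroup[OF normal] subgroup_perm_group[OF subgroup_induced] by blast+
    obtain m where m: "m \<in> M" "m \<noteq> \<one>\<^bsub>BijGroup (half e)\<^esub>"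
      using nt subgroup.one_closed[OF sub(1)] by auto
    then obtain g where g: "g \<in> X" "m = restrict g (half e)"
      using sub(2) by (auto simp: induced_def)
    have "g \<noteq> id"
      using m(2) g(2) by (auto simp: BijGroup_def id_def)
    then have "N_group \<subseteq> {g \<in> X. restrict g (half e) \<in> M}"
      using N_subset_normal[OF C' normal_preimage[OF normal, unfolded X_def]] m(1) g unfolding X_def by blast
    then show ?thesis
      using trans[OF sub(1)] by blast
  qed
  ultimately show ?thesis
    unfolding quasiprimitive_on_def quasiprimitive_def X_def by blast
qed

text \<open>Without \<open>(True, 0)\<close> all linear parts in \<open>Aff (plus_types C)\<close>
  are diagonal, so translations along the first axis form a normal subgroup; it never changes the
  second coordinate.\<close>

lemma not_quasiprimitive_on_half:
  assumes C: "type_subgroup C" "(True, 0) \<notin> C"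
  shows "\<not> quasiprimitive_on (Aff (plus_types C)) (half e :: 'p::prime_card vert set)"
proof
  define X :: "('p vert \<Rightarrow> 'p vert) set" where "X = Aff (plus_types C)"
  define W :: "('p mod_ring \<times> 'p mod_ring) set" where "W = {(u, v). v = 0}"
  define M where "M = (\<lambda>g. restrict g (half e)) ` {transl u v | u v. (u, v) \<in> W}"
  interpret invariant_subset X "half e"
    unfolding X_def by (rule invariant_half[OF C(1)])
  have "{transl u v | u v. (u, v) \<in> W} \<lhd> perm_group UNIV X"
    unfolding X_def using C(2)
    by (intro normal_translations[OF type_subgroup_plus[OF C(1)]]) (auto simp: W_def plus_types_def)
  then have normal: "M \<lhd> perm_group (half e) (induced X (half e))"
    unfolding M_def by (rule normal_image)
  then have sub: "subgroup M (BijGroup (half e))"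
    using normal_imp_subgroup subgroup_perm_group[OF subgroup_induced] by blast
  have "restrict (transl 1 0) (half e) \<in> M"
    by (auto simp: M_def W_def)
  moreover have "restrict (transl 1 0) (half e) \<noteq> \<one>\<^bsub>BijGroup (half e)\<^esub>"
  proof
    assume "restrict (transl 1 0) (half e) = \<one>\<^bsub>BijGroup (half e)\<^esub>"
    from fun_cong[OF this, of "(0, 0, e)"] show False
      by (simp add: BijGroup_def half_eq transl_def)
  qed
  ultimately have "nontrivial_normal (half e) (induced X (half e)) M"
    using normal by (auto simp: nontrivial_normal_def)
  moreover assume "quasiprimitive_on (Aff (plus_types C)) (half e :: 'p vert set)"
  ultimately have "transitive_perm (half e) M"
    by (auto simp: quasiprimitive_on_def quasiprimitive_def X_def)
  then have "\<exists>g\<in>M. g (0, 0, e) = (0, 1, e)"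
    unfolding transitive_perm_iff[OF sub] by (simp add: half_eq)
  then obtain g where "g \<in> M" "g (0, 0, e) = (0, 1, e)"
    by blast
  then show False
    by (auto simp: M_def W_def transl_def half_eq)
qed

section \<open>Adjacency in \<open>\<Sigma>\<close>\<close>

text \<open>Labels each edge by a cube root of unity. The sign makes \<open>nb q\<close> an
  involution, so the label is the same from both ends and one formula serves both halves.\<close>

definition nb :: "'p::prime_card mod_ring \<Rightarrow> 'p vert \<Rightarrow> 'p vert" where
  "nb q = (\<lambda>(x, y, e). (x + sg e * q, y + sg e * q\<^sup>2, e + 1))"

lemma sg_add_1 [simp]: "sg (e + 1) = - sg e" "sg (1 + e) = - sg e"
  by (simp_all add: sg_add)

lemma nb_third [simp]: "snd (snd (nb q w)) = snd (snd w) + 1"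
  by (simp add: nb_def split: prod.splits)

lemma nb_nb [simp]: "nb q (nb q w) = w"
  by (cases w) (simp add: nb_def add.assoc)

lemma nb_inject [simp]: "nb q w = nb r w \<longleftrightarrow> q = r"
  by (cases w) (auto simp: nb_def)

text \<open>An affine map permutes the edge labels in the same way at every vertex: the translation
  drops out and the sign is absorbed by the half of the image vertex.\<close>

lemma aff_nb:
  assumes "q ^ 3 = 1"
  shows "aff r s d u v (nb q w) = nb (r * (if s then q\<^sup>2 else q)) (aff r s d u v w)"
proof -
  have *: "q ^ 4 = q"
    using assms by (simp add: eval_nat_numeral mult.assoc)
  show ?thesis
    by (cases w) (auto simp: nb_def aff_def sg_add power_mult_distrib * algebra_simps)
qed

lemma aff_origin: "aff r s d u v (0, 0, 0) = (u, v, d)"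
  by (simp add: aff_def)

lemma automorphisms_UNIV: "g \<in> automorphisms UNIV E \<longleftrightarrow> bij g \<and> (\<forall>u v. {u, v} \<in> E \<longleftrightarrow> {g u, g v} \<in> E)"
  by (simp add: automorphisms_def)

lemma automorphism_edge:
  assumes "g \<in> automorphisms UNIV E"
  shows "{g u, g v} \<in> E \<longleftrightarrow> {u, v} \<in> E"
  using assms unfolding automorphisms_UNIV by blast

lemma automorphism_eq_iff:
  assumes "g \<in> automorphisms UNIV E"
  shows "g u = g v \<longleftrightarrow> u = v"
  using assms unfolding automorphisms_UNIV by (blast dest: bij_is_inj injD)

context cube_root
begin

lemma edge_iff: "{w, w'} \<in> Sigma_edges a \<longleftrightarrow> (\<exists>q. q ^ 3 = 1 \<and> w' = nb q w)"
proof -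
  \<comment> \<open>Needed to recognise the third offset \<open>(a\<^sup>2, a)\<close> as
    \<open>(q, q\<^sup>2)\<close> with \<open>q = a\<^sup>2\<close>.\<close>
  have a4: "a ^ 4 = a"
    using a_cube by (simp add: eval_nat_numeral mult.assoc)
  have nb0: "nb q (x, y, 0) = (x + q, y + q\<^sup>2, 1)" for q x y :: "'p mod_ring"
    by (simp add: nb_def)
  have "Z \<in> Sigma_edges a \<longleftrightarrow> (\<exists>x y. Z = {(x, y, 0), nb 1 (x, y, 0)} \<or>
      Z = {(x, y, 0), nb a (x, y, 0)} \<or> Z = {(x, y, 0), nb (a\<^sup>2) (x, y, 0)})" for Z
    by (simp add: Sigma_edges_def nb0 a4)
  then have "Z \<in> Sigma_edges a \<longleftrightarrow> (\<exists>x y q. q ^ 3 = 1 \<and> Z = {(x, y, 0), nb q (x, y, 0)})" for Z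
    unfolding cube_roots by metis
  then have "{w, w'} \<in> Sigma_edges a \<longleftrightarrow>
      (\<exists>x y q. q ^ 3 = 1 \<and> (w = (x, y, 0) \<and> w' = nb q (x, y, 0) \<or> w = nb q (x, y, 0) \<and> w' = (x, y, 0)))"
    by (simp add: doubleton_eq_iff)
  also have "\<dots> \<longleftrightarrow> (\<exists>q. q ^ 3 = 1 \<and> w' = nb q w)"
  proof
    assume "\<exists>q. q ^ 3 = 1 \<and> w' = nb q w"
    then obtain q where q: "q ^ 3 = 1" "w' = nb q w"
      by blast
    \<comment> \<open>\<open>Sigma_edges\<close> lists each edge from its end in half 0; if that end
      is \<open>w'\<close>, the involution turns the edge round.\<close>
    then have w: "w = nb q w'"
      by simp
    show "\<exists>x y q. q ^ 3 = 1 \<and> (w = (x, y, 0) \<and> w' = nb q (x, y, 0) \<or> w = nb q (x, y, 0) \<and> w' = (x, y, 0))"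
    proof (cases "snd (snd w)")
      case zero
      then show ?thesis
        using q by (metis prod.collapse)
    next
      case one
      then have "snd (snd w') = 0"
        using q by simp
      then show ?thesis
        using q w by (metis prod.collapse)
    qed
  qed auto
  finally show ?thesis .
qed

lemma Aff_automorphisms: "Aff C \<subseteq> automorphisms UNIV (Sigma_edges a)"
proof
  fix g :: "'p vert \<Rightarrow> 'p vert" assume "g \<in> Aff C"
  then have "g \<in> Aff UNIV"
    by (auto elim!: AffE intro: aff_in_Aff)
  have preserve: "{g u, g v} \<in> Sigma_edges a" if e: "{u, v} \<in> Sigma_edges a" "g \<in> Aff UNIV" for g u v
  proof -
    obtain q where q: "q ^ 3 = 1" "v = nb q u"
      using e(1) unfolding edge_iff by blast
    obtain r s d u' v' where g: "g = aff r s d u' v'" "r ^ 3 = 1"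
      using e(2) by (elim AffE)
    have "(r * (if s then q\<^sup>2 else q)) ^ 3 = 1"
      using q g by (auto intro: cube_mult cube_square)
    then show ?thesis
      unfolding edge_iff g(1) q(2) aff_nb[OF q(1)] by blast
  qed
  obtain h where h: "h \<in> Aff UNIV" "h \<circ> g = id"
  proof -
    obtain r s d u v where g: "g = aff r s d u v" "r ^ 3 = 1"
      using \<open>g \<in> Aff C\<close> by (elim AffE)
    obtain u' v' where "aff (if s then r else r\<^sup>2) s d u' v' \<circ> g = id"
      using aff_inverse[OF g(2)] g(1) by metis
    then show thesis
      using that g(2) by (metis UNIV_I aff_in_Aff cube_square)
  qed
  have "{u, v} \<in> Sigma_edges a \<longleftrightarrow> {g u, g v} \<in> Sigma_edges a" for u v
    using preserve[of u v g] preserve[of "g u" "g v" h] h(1) fun_cong[OF h(2)] \<open>g \<in> Aff UNIV\<close>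
    by (metis comp_apply id_apply)
  then show "g \<in> automorphisms UNIV (Sigma_edges a)"
    using Aff_bij[OF \<open>g \<in> Aff C\<close>] by (simp add: automorphisms_UNIV)
qed

lemma automorphism_nb:
  assumes "g \<in> automorphisms UNIV (Sigma_edges a)" "q ^ 3 = 1"
  obtains r where "r ^ 3 = 1" "g (nb q w) = nb r (g w)"
proof -
  have "{w, nb q w} \<in> Sigma_edges a"
    using assms(2) edge_iff by blast
  then have "{g w, g (nb q w)} \<in> Sigma_edges a"
    by (rule iffD2[OF automorphism_edge[OF assms(1)]])
  then show ?thesis
    using that edge_iff by blast
qed

section \<open>Short arcs and connectedness\<close>

lemma arcs_1: "arcs UNIV (Sigma_edges a) 1 = {[w, nb q w] | w q. q ^ 3 = 1}"
proof -
  have "vs \<in> arcs UNIV (Sigma_edges a) 1 \<longleftrightarrow> (\<exists>w w'. vs = [w, w'] \<and> {w, w'} \<in> Sigma_edges a)" for vs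
    by (cases vs rule: remdups_adj.cases) (auto simp: arcs_def)
  then show ?thesis
    unfolding edge_iff by blast
qed

text \<open>Seen from its middle vertex, a 2-arc is a pair of labels, and not backtracking means
  that they differ.\<close>

lemma arcs_2:
  "arcs UNIV (Sigma_edges a) 2 = {[nb q w, w, nb q' w] | w q q'. q ^ 3 = 1 \<and> q' ^ 3 = 1 \<and> q \<noteq> q'}"
proof -
  have "vs \<in> arcs UNIV (Sigma_edges a) 2 \<longleftrightarrow>
      (\<exists>x w y. vs = [x, w, y] \<and> {w, x} \<in> Sigma_edges a \<and> {w, y} \<in> Sigma_edges a \<and> x \<noteq> y)" for vs
  proof
    assume *: "vs \<in> arcs UNIV (Sigma_edges a) 2"
    then obtain x w y where "vs = [x, w, y]"
      by (auto simp: arcs_def numeral_3_eq_3 length_Suc_conv)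
    moreover have "{vs ! 0, vs ! 1} \<in> Sigma_edges a" "{vs ! 1, vs ! 2} \<in> Sigma_edges a" "vs ! 0 \<noteq> vs ! 2"
      using * unfolding arcs_def
      by (auto dest: spec[of _ "0::nat"] spec[of _ "1::nat"] simp: numeral_2_eq_2)
    ultimately show "\<exists>x w y. vs = [x, w, y] \<and> {w, x} \<in> Sigma_edges a \<and> {w, y} \<in> Sigma_edges a \<and> x \<noteq> y"
      by (auto simp: insert_commute)
  next
    assume "\<exists>x w y. vs = [x, w, y] \<and> {w, x} \<in> Sigma_edges a \<and> {w, y} \<in> Sigma_edges a \<and> x \<noteq> y"
    then show "vs \<in> arcs UNIV (Sigma_edges a) 2"
      by (auto simp: arcs_def less_Suc_eq numeral_2_eq_2 insert_commute le_Suc_eq)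
  qed
  then have "vs \<in> arcs UNIV (Sigma_edges a) 2 \<longleftrightarrow>
      (\<exists>w q q'. vs = [nb q w, w, nb q' w] \<and> q ^ 3 = 1 \<and> q' ^ 3 = 1 \<and> nb q w \<noteq> nb q' w)" for vs
    unfolding edge_iff by blast
  then show ?thesis
    unfolding nb_inject by blast
qed

text \<open>The vectors whose translation keeps every vertex in its component are closed under
  addition and stable under \<open>tau a\<close> and the swap, so by \<open>irreducible\<close> a
  single nonzero one suffices. A path of two edges with different labels supplies it.\<close>

lemma connected_Sigma: "connected_graph UNIV (Sigma_edges a)"
proof -
  define R where "R = {(x, y). {x, y} \<in> Sigma_edges a}"
  have nb_R: "(w, nb q w) \<in> R\<^sup>*" if "q ^ 3 = 1" for q w
    using that by (intro r_into_rtrancl) (auto simp: R_def edge_iff)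
  have aut: "(g x, g y) \<in> R\<^sup>*" if "(x, y) \<in> R\<^sup>*" "g \<in> Aff UNIV" for g x y
    using that(1)
  proof (induction rule: rtrancl_induct)
    case (step y z)
    moreover have "g \<in> automorphisms UNIV (Sigma_edges a)"
      using Aff_automorphisms that(2) by blast
    ultimately have "(g y, g z) \<in> R"
      by (simp add: R_def automorphism_edge)
    then show ?case
      using step.IH by (rule rtrancl_into_rtrancl[rotated])
  qed simp
  define W where "W = {(u, v). \<forall>w. (w, transl u v w) \<in> R\<^sup>*}"
  have W_iff: "(u, v) \<in> W \<longleftrightarrow> (\<forall>w. (w, transl u v w) \<in> R\<^sup>*)" for u v
    by (simp only: W_def mem_Collect_eq case_prod_conv)
  have conj: "(r * (if s then v else u), r\<^sup>2 * (if s then u else v)) \<in> W"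
    if uv: "(u, v) \<in> W" and r: "r ^ 3 = 1" for r s u v
  proof -
    define g where "g = aff r s 0 0 0"
    obtain h where h: "h \<circ> g = id" "g \<circ> h = id"
      using aff_inverse[OF r] g_def by metis
    have "g \<in> Aff UNIV"
      unfolding g_def by (intro aff_in_Aff r UNIV_I)
    then have "(g (h w), g (transl u v (h w))) \<in> R\<^sup>*" for w
      using uv aut unfolding W_iff by blast
    moreover have "g (h w) = w" "g (transl u v (h w)) = transl (r * (if s then v else u)) (r\<^sup>2 * (if s then u else v)) w" for w
      using fun_cong[OF h(2), of w] fun_cong[OF conj_transl[OF h(2)[unfolded g_def], of u v], of w]
      by (simp_all add: g_def)
    ultimately show ?thesis
      unfolding W_iff by simp
  qed
  have "W = UNIV"
  proof (rule irreducible[where k = 1])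
    fix u v u' v' assume uv: "(u, v) \<in> W" "(u', v') \<in> W"
    have "(w, transl (u + u') (v + v') w) \<in> R\<^sup>*" for w
    proof -
      have "(w, transl u' v' w) \<in> R\<^sup>*" "(transl u' v' w, transl u v (transl u' v' w)) \<in> R\<^sup>*"
        using uv unfolding W_iff by blast+
      then show ?thesis
        unfolding transl_comp[symmetric] comp_apply by (rule rtrancl_trans)
    qed
    then show "(u + u', v + v') \<in> W"
      unfolding W_iff by blast
  next
    fix u v assume "(u, v) \<in> W"
    then show "(a * u, a\<^sup>2 * v) \<in> W" "(1 * v, 1 * u) \<in> W"
      using conj[of u v a False] conj[of u v 1 True] a_cube by simp_all
  next
    have two: "(w, nb r (nb q w)) \<in> R\<^sup>*" if "q ^ 3 = 1" "r ^ 3 = 1" for q r w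
      using nb_R[OF that(1)] nb_R[OF that(2)] by (rule rtrancl_trans)
    \<comment> \<open>The sign of a step depends on the half, so the labels 1 and \<open>a\<close>
      are used in opposite orders in the two halves.\<close>
    have "(w, transl (1 - a) (1 - a\<^sup>2) w) \<in> R\<^sup>*" for w
    proof (cases "snd (snd w)")
      case zero
      then have "transl (1 - a) (1 - a\<^sup>2) w = nb a (nb 1 w)"
        by (cases w) (simp add: transl_def nb_def)
      then show ?thesis
        using two[of 1 a w] a_cube by simp
    next
      case one
      then have "transl (1 - a) (1 - a\<^sup>2) w = nb 1 (nb a w)"
        by (cases w) (simp add: transl_def nb_def)
      then show ?thesis
        using two[of a 1 w] a_cube by simp
    qed
    then show "(1 - a, 1 - a\<^sup>2) \<in> W"
      unfolding W_iff by blast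
    show "(1 - a, 1 - a\<^sup>2) \<noteq> (0, 0)" "(1 :: 'p mod_ring) \<noteq> 0"
      using a_neq_1 by auto
  qed
  then have tr: "(w, transl u v w) \<in> R\<^sup>*" for u v w
    using W_iff by blast
  have same: "(w, w') \<in> R\<^sup>*" if e: "snd (snd w) = snd (snd w')" for w w'
    by (rule transl_transitive[OF e]) (use tr in blast)
  have "(w, w') \<in> R\<^sup>*" for w w'
  proof (cases "snd (snd w) = snd (snd w')")
    case False
    then have "snd (snd (nb 1 w)) = snd (snd w')"
      by (cases "snd (snd w)"; cases "snd (snd w')") auto
    then show ?thesis
      using rtrancl_trans[OF nb_R[OF power_one, of w] same] by blast
  qed (rule same)
  then show ?thesis
    unfolding connected_graph_def R_def by simp
qed

section \<open>Arc-transitivity\<close>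

lemma transitive_on_arcs:
  assumes X: "subgroup X (BijGroup UNIV)" and base: "\<And>vs. vs \<in> S \<Longrightarrow> \<exists>g\<in>X. map g base = vs"
    and "vs \<in> S" "ws \<in> S"
  shows "\<exists>g\<in>X. map g vs = ws"
proof -
  obtain g h where gh: "g \<in> X" "map g base = vs" "h \<in> X" "map h base = ws"
    using base assms(3,4) by meson
  define k where "k = inv\<^bsub>BijGroup UNIV\<^esub> g"
  have k: "k \<in> X"
    unfolding k_def using gh subgroup.m_inv_closed[OF X] by simp
  have b: "f \<in> X \<Longrightarrow> bij f" for f
    using subgroup.subset[OF X] by auto
  have "k \<circ> g = id"
    using group.l_inv[OF group_BijGroup, of g UNIV] gh k b by (simp add: mult_BijGroup_UNIV flip: k_def)
  then have "map (h \<circ> k) vs = ws"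
    using gh by (metis comp_assoc comp_id map_map)
  moreover have "h \<circ> k \<in> X"
    using subgroup.m_closed[OF X gh(3) k] gh k b by (simp add: mult_BijGroup_UNIV)
  ultimately show ?thesis
    by blast
qed

lemma arc_transitive_1:
  assumes C: "type_subgroup C" "\<And>d. \<exists>s. (s, d) \<in> C"
  shows "arc_transitive UNIV (Sigma_edges a) (Aff C) 1"
proof -
  have "\<exists>g\<in>Aff C. map g [(0, 0, 0), nb 1 (0, 0, 0)] = vs" if vs: "vs \<in> arcs UNIV (Sigma_edges a) 1" for vs
  proof -
    obtain w q where "vs = [w, nb q w]" and q: "q ^ 3 = 1"
      using vs unfolding arcs_1 by blast
    moreover obtain x y d where "w = (x, y, d)"
      by (cases w)
    moreover obtain s where s: "(s, d) \<in> C"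
      using C by blast
    \<comment> \<open>The origin goes to \<open>w\<close> by the choice of \<open>x\<close>,
      \<open>y\<close> and \<open>d\<close>; the label 1 goes to \<open>q\<close> for either value
      of \<open>s\<close>, so any type with this \<open>d\<close> will do.\<close>
    ultimately show ?thesis
      using aff_in_Aff[OF q s] by (intro bexI[of _ "aff q s d x y"]) (simp_all add: aff_origin aff_nb)
  qed
  then have trans: "\<exists>g\<in>Aff C. map g vs = ws"
    if "vs \<in> arcs UNIV (Sigma_edges a) 1" "ws \<in> arcs UNIV (Sigma_edges a) 1" for vs ws
    using transitive_on_arcs[OF subgroup_Aff[OF C(1)] _ that] by blast
  show ?thesis
    unfolding arc_transitive_def
  proof (intro conjI allI impI ballI connected_Sigma)
    show "arcs UNIV (Sigma_edges a) 1 \<noteq> {}"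
      unfolding arcs_1 using power_one by blast
  next
    fix i vs ws
    assume "1 \<le> i \<and> i \<le> (1 :: nat)" "vs \<in> arcs UNIV (Sigma_edges a) i" "ws \<in> arcs UNIV (Sigma_edges a) i"
    moreover from this have "i = 1"
      by simp
    ultimately show "\<exists>g\<in>Aff C. map g vs = ws"
      using trans by blast
  qed
qed

lemma base_2_arc:
  assumes "vs \<in> arcs UNIV (Sigma_edges a) 2"
  shows "\<exists>g\<in>Aff UNIV. map g [nb 1 (0, 0, 0), (0, 0, 0), nb a (0, 0, 0)] = vs"
proof -
  obtain w q q' where vs: "vs = [nb q w, w, nb q' w]" and q: "q ^ 3 = 1" "q' ^ 3 = 1" "q \<noteq> q'"
    using assms unfolding arcs_2 by blast
  obtain x y d where w: "w = (x, y, d)"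
    by (cases w)
  \<comment> \<open>The ratio of \<open>q'\<close> to \<open>q\<close>, a cube root of unity other
    than 1. Whether it is \<open>a\<close> or \<open>a\<^sup>2\<close> decides whether a swap is
    used.\<close>
  define c where "c = q\<^sup>2 * q'"
  have q': "q' = q * c"
    using q(1) by (simp add: c_def eval_nat_numeral mult.assoc)
  have "c ^ 3 = 1"
    unfolding c_def using q by (intro cube_mult cube_square)
  moreover have "c \<noteq> 1"
    using q' q(3) by auto
  ultimately have "c = a \<or> c = a\<^sup>2"
    unfolding cube_roots by blast
  then obtain s where s: "q' = q * (if s then a\<^sup>2 else a)"
    using that[of False] that[of True] by (auto simp: q')
  then have "map (aff q s d x y) [nb 1 (0, 0, 0), (0, 0, 0), nb a (0, 0, 0)] = vs"
    using a_cube by (simp add: vs w aff_nb aff_origin)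
  then show ?thesis
    using aff_in_Aff[OF q(1), of s d UNIV] by blast
qed

lemma arc_transitive_2: "arc_transitive UNIV (Sigma_edges a) (Aff UNIV) 2"
proof -
  have "arc_transitive UNIV (Sigma_edges a) (Aff UNIV) 1"
    by (rule arc_transitive_1[OF type_subgroup_UNIV]) simp
  then have one: "\<exists>g\<in>Aff UNIV. map g vs = ws"
    if "vs \<in> arcs UNIV (Sigma_edges a) 1" "ws \<in> arcs UNIV (Sigma_edges a) 1" for vs ws
    using that unfolding arc_transitive_def by blast
  show ?thesis
    unfolding arc_transitive_def
  proof (intro conjI allI impI ballI connected_Sigma)
    have "[nb 1 (0, 0, 0), (0, 0, 0), nb a (0, 0, 0)] \<in> arcs UNIV (Sigma_edges a) 2"
      unfolding arcs_2 using a_cube a_neq_1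
      by (intro CollectI exI[of _ "(0, 0, 0)"] exI[of _ 1] exI[of _ a]) auto
    then show "arcs UNIV (Sigma_edges a) 2 \<noteq> {}"
      by blast
  next
    fix i vs ws
    assume *: "1 \<le> i \<and> i \<le> (2 :: nat)" "vs \<in> arcs UNIV (Sigma_edges a) i" "ws \<in> arcs UNIV (Sigma_edges a) i"
    then consider "i = 1" | "i = 2"
      by linarith
    then show "\<exists>g\<in>Aff UNIV. map g vs = ws"
    proof cases
      case 1
      then show ?thesis
        using one * by blast
    next
      case 2
      then show ?thesis
        using transitive_on_arcs[OF subgroup_Aff[OF type_subgroup_UNIV] base_2_arc] * by blast
    qed
  qed
qed

text \<open>Reversing a 2-arc fixes its middle vertex, so \<open>d = 0\<close> and hence no swap.
  Labels are then merely multiplied by \<open>r\<close>, and a product with a cube root of unity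
  cannot exchange 1 and \<open>a\<close>.\<close>

lemma not_arc_transitive_2:
  assumes "(True, 0) \<notin> C"
  shows "\<not> arc_transitive UNIV (Sigma_edges a) (Aff C) 2"
proof
  define w :: "'p vert" where "w = (0, 0, 0)"
  assume "arc_transitive UNIV (Sigma_edges a) (Aff C) 2"
  moreover have "[nb 1 w, w, nb a w] \<in> arcs UNIV (Sigma_edges a) 2" "[nb a w, w, nb 1 w] \<in> arcs UNIV (Sigma_edges a) 2"
    unfolding arcs_2 using a_cube a_neq_1 a_neq_1[symmetric] power_one by blast+
  ultimately obtain g where g: "g \<in> Aff C" "map g [nb 1 w, w, nb a w] = [nb a w, w, nb 1 w]"
    unfolding arc_transitive_def by (metis le_refl one_le_numeral)
  obtain r s d u v where g': "g = aff r s d u v" "(s, d) \<in> C"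
    using g(1) by (elim AffE)
  have "(u, v, d) = (0, 0, 0)"
    using g(2) by (simp add: g' w_def aff_origin)
  moreover from this have "\<not> s"
    using g' assms by (cases s) auto
  ultimately have "r = a" "r * a = 1"
    using g(2) a_cube by (auto simp: g'(1) aff_nb w_def aff_origin)
  then show False
    using a2_neq_1 by (simp add: power2_eq_square)
qed

section \<open>The full automorphism group\<close>

text \<open>If \<open>g\<close> moved \<open>x1 = nb q' (nb q w)\<close>, it would move it to \<open>nb k (nb q w)\<close> for the third root \<open>k\<close>. The
  path from \<open>x1\<close> through \<open>x2\<close> and \<open>x3\<close> to \<open>nb k w\<close> completes the hexagon through \<open>nb k w, w, nb q w, x1\<close>,
  whereas its image would have to backtrack immediately.\<close>

lemma rigid_step:
  assumes g: "g \<in> automorphisms UNIV (Sigma_edges a)"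
    and fixed: "\<And>q. q ^ 3 = 1 \<Longrightarrow> g (nb q w) = nb q w" "g w = w"
    and q: "q ^ 3 = 1" "q' ^ 3 = 1"
  shows "g (nb q' (nb q w)) = nb q' (nb q w)"
proof (rule ccontr)
  assume moved: "g (nb q' (nb q w)) \<noteq> nb q' (nb q w)"
  note inj = automorphism_eq_iff[OF g]
  define w1 where "w1 = nb q w"
  have w1: "g w1 = w1" "nb q w1 = w"
    using fixed q by (auto simp: w1_def)
  obtain k where k: "k ^ 3 = 1" "g (nb q' w1) = nb k w1"
    using automorphism_nb[OF g q(2), of w1] w1 by metis
  have "k \<noteq> q'"
    using moved k by (auto simp: w1_def)
  have "k \<noteq> q"
  proof
    assume "k = q"
    then have "g (nb q' w1) = g (nb q w1)"
      using k w1 fixed by simp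
    then have "q' = q"
      by (simp add: inj)
    then show False
      using \<open>k \<noteq> q'\<close> \<open>k = q\<close> by simp
  qed
  define x1 where "x1 = nb q' w1"
  define x2 where "x2 = nb k x1"
  define x3 where "x3 = nb q x2"
  obtain \<alpha> where \<alpha>: "\<alpha> ^ 3 = 1" "g x2 = nb \<alpha> (nb k w1)"
    using automorphism_nb[OF g k(1), of x1] k(2) unfolding x2_def x1_def by metis
  obtain \<beta> where \<beta>: "\<beta> ^ 3 = 1" "g x3 = nb \<beta> (nb \<alpha> (nb k w1))"
    using automorphism_nb[OF g q(1), of x2] \<alpha>(2) unfolding x3_def by metis
  obtain \<gamma> where \<gamma>: "\<gamma> ^ 3 = 1" "g (nb q' x3) = nb \<gamma> (nb \<beta> (nb \<alpha> (nb k w1)))"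
    using automorphism_nb[OF g q(2), of x3] \<beta>(2) by metis
  \<comment> \<open>Successive steps alternate in sign, and
    \<open>q - q' + k - q + q' = k\<close>.\<close>
  have "nb q' x3 = nb k w"
    by (cases w) (simp add: x3_def x2_def x1_def w1_def nb_def algebra_simps)
  then have closed: "nb \<gamma> (nb \<beta> (nb \<alpha> (nb k (nb q w)))) = nb k w"
    using \<gamma>(2) fixed(1)[OF k(1)] by (simp add: w1_def)
  obtain x y e where w: "w = (x, y, e)"
    by (cases w)
  have "sg e * (q - k + \<alpha> - \<beta> + \<gamma>) = sg e * k" "sg e * (q\<^sup>2 - k\<^sup>2 + \<alpha>\<^sup>2 - \<beta>\<^sup>2 + \<gamma>\<^sup>2) = sg e * k\<^sup>2"
    using closed by (simp_all add: w nb_def algebra_simps)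
  then have "q - k + \<alpha> - \<beta> + \<gamma> = k" "q\<^sup>2 - k\<^sup>2 + \<alpha>\<^sup>2 - \<beta>\<^sup>2 + \<gamma>\<^sup>2 = k\<^sup>2"
    by simp_all
  then have sums: "q = 2 * k - \<alpha> + \<beta> - \<gamma>" "q\<^sup>2 = 2 * k\<^sup>2 - \<alpha>\<^sup>2 + \<beta>\<^sup>2 - \<gamma>\<^sup>2"
    by (simp_all add: algebra_simps)
  \<comment> \<open>This is \<open>separation\<close> for the root \<open>k\<close>. In both
    equations of \<open>sums\<close> the coefficients on the right total 1, so the constant terms of
    \<open>f\<close> cancel.\<close>
  define f where "f z = 1 + k\<^sup>2 * z + k * z\<^sup>2" for z
  have f: "f z = (if z = k then 3 else 0)" if "z ^ 3 = 1" for z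
    using separation[OF k(1) that] by (simp add: f_def)
  have "f q + f \<alpha> + f \<gamma> - (2 * f k + f \<beta>) =
      k\<^sup>2 * (q - (2 * k - \<alpha> + \<beta> - \<gamma>)) + k * (q\<^sup>2 - (2 * k\<^sup>2 - \<alpha>\<^sup>2 + \<beta>\<^sup>2 - \<gamma>\<^sup>2))"
    by (simp add: f_def algebra_simps)
  then have "f q + f \<alpha> + f \<gamma> = 2 * f k + f \<beta>"
    by (simp only: sums[symmetric] diff_self mult_zero_right add_0_right eq_iff_diff_eq_0[symmetric])
  \<comment> \<open>The left side is 0, 3 or 6 and the right side 6 or 9. As 2 and 3 are nonzero in
    the field, only 6 = 6 with \<open>\<alpha> = \<gamma> = k\<close> remains.\<close>
  then have "(if \<alpha> = k then 3 else 0) + (if \<gamma> = k then 3 else 0) = (6 :: 'p mod_ring) + (if \<beta> = k then 3 else 0)"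
    using f q k \<alpha> \<beta> \<gamma> \<open>k \<noteq> q\<close> by auto
  moreover have "(6 :: 'p mod_ring) \<noteq> 0" "(9 :: 'p mod_ring) \<noteq> 0" "(6 :: 'p mod_ring) \<noteq> 3" "(9 :: 'p mod_ring) \<noteq> 3"
  proof -
    have "(6 :: 'p mod_ring) = 2 * 3" "(9 :: 'p mod_ring) = 3 * 3" "(6 :: 'p mod_ring) - 3 = 3" "(9 :: 'p mod_ring) - 3 = 2 * 3"
      by simp_all
    then show "(6 :: 'p mod_ring) \<noteq> 0" "(9 :: 'p mod_ring) \<noteq> 0" "(6 :: 'p mod_ring) \<noteq> 3" "(9 :: 'p mod_ring) \<noteq> 3"
      using two_neq_0 three_neq_0 by (metis divisors_zero diff_self)+
  qed
  ultimately have "\<alpha> = k"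
    using three_neq_0[symmetric] by (auto split: if_splits)
  \<comment> \<open>The image path uses the label \<open>k\<close> twice in a row and returns to
    \<open>w1\<close>; by injectivity \<open>x2\<close> would be \<open>w1\<close>.\<close>
  then have "g x2 = g w1"
    using \<alpha>(2) w1 by simp
  then have "nb k x1 = nb k (nb k w1)"
    using inj by (simp add: x2_def)
  then have "x1 = nb k w1"
    by (metis nb_nb)
  then show False
    using \<open>k \<noteq> q'\<close> by (simp add: x1_def)
qed

text \<open>The property carried along paths is that a vertex and all its neighbours are fixed:
  \<open>rigid_step\<close> needs the neighbours and reproduces this property at an adjacent
  vertex.\<close>

lemma rigid:
  assumes g: "g \<in> automorphisms UNIV (Sigma_edges a)"
    and fixed: "\<And>q. q ^ 3 = 1 \<Longrightarrow> g (nb q w) = nb q w" "g w = w"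
  shows "g = id"
proof -
  have "g w' = w' \<and> (\<forall>q. q ^ 3 = 1 \<longrightarrow> g (nb q w') = nb q w')" for w'
  proof -
    have "(w, w') \<in> {(x, y). x \<in> UNIV \<and> y \<in> UNIV \<and> {x, y} \<in> Sigma_edges a}\<^sup>*"
      using connected_Sigma unfolding connected_graph_def by blast
    then show ?thesis
    proof (induction rule: rtrancl_induct)
      case base
      then show ?case
        using fixed by blast
    next
      case (step y z)
      then obtain q where "q ^ 3 = 1" "z = nb q y"
        using edge_iff by auto
      then show ?case
        using step.IH rigid_step[OF g, of y q] by blast
    qed
  qed
  then show ?thesis
    by (simp add: fun_eq_iff)
qed

text \<open>An automorphism sends the base 2-arc to a 2-arc, where some affine \<open>h\<close>
  agrees with it. The quotient \<open>f\<close> fixes the origin and all its neighbours, so it is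
  trivial by \<open>rigid\<close>.\<close>

lemma automorphisms_eq: "automorphisms UNIV (Sigma_edges a) = Aff UNIV"
proof
  show "automorphisms UNIV (Sigma_edges a) \<subseteq> Aff UNIV"
  proof
    fix g assume g: "g \<in> automorphisms UNIV (Sigma_edges a)"
    define w :: "'p vert" where "w = (0, 0, 0)"
    note inj = automorphism_eq_iff[OF g]
    obtain q where q: "q ^ 3 = 1" "g (nb 1 w) = nb q (g w)"
      using automorphism_nb[OF g power_one, of w] .
    obtain q' where q': "q' ^ 3 = 1" "g (nb a w) = nb q' (g w)"
      using automorphism_nb[OF g a_cube, of w] .
    have "q \<noteq> q'"
      using q(2) q'(2) inj a_neq_1 by (metis nb_inject)
    then have "[nb q (g w), g w, nb q' (g w)] \<in> arcs UNIV (Sigma_edges a) 2"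
      unfolding arcs_2 using q q' by blast
    from base_2_arc[OF this] obtain h
      where h: "h \<in> Aff UNIV" "h (nb 1 w) = g (nb 1 w)" "h w = g w" "h (nb a w) = g (nb a w)"
      unfolding w_def[symmetric] q(2)[symmetric] q'(2)[symmetric] by auto
    have h': "h \<in> automorphisms UNIV (Sigma_edges a)"
      using h(1) Aff_automorphisms by blast
    define f where "f = inv_into UNIV h \<circ> g"
    have bij: "bij h"
      using h(1) by (rule Aff_bij)
    have f: "f \<in> automorphisms UNIV (Sigma_edges a)"
    proof -
      have "{u, v} \<in> Sigma_edges a \<longleftrightarrow> {inv_into UNIV h u, inv_into UNIV h v} \<in> Sigma_edges a" for u v
        using automorphism_edge[OF h', of "inv_into UNIV h u" "inv_into UNIV h v"] bij
        by (simp add: surj_f_inv_f bij_is_surj)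
      then have "{u, v} \<in> Sigma_edges a \<longleftrightarrow> {f u, f v} \<in> Sigma_edges a" for u v
        using automorphism_edge[OF g, of u v] by (simp add: f_def)
      moreover have "bij g"
        using g automorphisms_UNIV by blast
      then have "bij f"
        unfolding f_def using bij by (intro bij_comp bij_imp_bij_inv)
      ultimately show ?thesis
        unfolding automorphisms_UNIV by blast
    qed
    have fixed: "f w = w" "f (nb 1 w) = nb 1 w" "f (nb a w) = nb a w"
      using h bij by (metis f_def comp_apply bij_inv_eq_iff)+
    \<comment> \<open>The image of the third neighbour is a neighbour distinct from the two fixed
      ones, hence the third neighbour itself.\<close>
    obtain r where r: "r ^ 3 = 1" "f (nb (a\<^sup>2) w) = nb r w"
      using automorphism_nb[OF f cube_square[OF a_cube], of w] fixed(1) by metis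
    note inj' = automorphism_eq_iff[OF f]
    have "r \<noteq> 1" "r \<noteq> a"
      using r(2) fixed inj' a2_neq_1 a_neq_a2 by (metis nb_inject)+
    then have "r = a\<^sup>2"
      using r(1) cube_roots by blast
    then have "f (nb q w) = nb q w" if "q ^ 3 = 1" for q
      using that r(2) fixed unfolding cube_roots by auto
    then have "f = id"
      using rigid[OF f] fixed(1) by blast
    then have "g x = h x" for x
      using bij by (metis f_def comp_apply bij_inv_eq_iff id_apply)
    then have "g = h"
      by blast
    then show "g \<in> Aff UNIV"
      using h(1) by simp
  qed
qed (rule Aff_automorphisms)

end

section \<open>Semidirect decompositions\<close>

lemma set_mult_N_Lin: "N_group <#>\<^bsub>BijGroup UNIV\<^esub> Lin C = Aff C"
proof -
  have *: "transl u v \<otimes>\<^bsub>BijGroup UNIV\<^esub> aff r s d 0 0 = aff r s d u v" if "r ^ 3 = 1" for u v r s d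
    using that by (simp add: mult_BijGroup_UNIV transl_bij bij_aff) (auto simp: transl_def aff_def fun_eq_iff)
  show ?thesis
  proof
    show "N_group <#>\<^bsub>BijGroup UNIV\<^esub> Lin C \<subseteq> Aff C"
      by (auto simp: set_mult_def N_group_def * intro: aff_in_Aff elim!: LinE)
    show "Aff C \<subseteq> N_group <#>\<^bsub>BijGroup UNIV\<^esub> Lin C"
    proof
      fix g assume "g \<in> Aff C"
      then obtain r s d u v where g: "g = aff r s d u v" "r ^ 3 = 1" "(s, d) \<in> C"
        by (elim AffE)
      then show "g \<in> N_group <#>\<^bsub>BijGroup UNIV\<^esub> Lin C"
        unfolding set_mult_def using *[OF g(2), of u v s d] transl_in_N[of u v] aff_in_Lin[OF g(2,3)] by blast
    qed
  qed
qed

lemma internal_semidirect_Aff: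
  assumes C: "type_subgroup C"
  shows "internal_semidirect (perm_group UNIV (Aff C)) N_group (Lin C :: ('p::prime_card vert \<Rightarrow> 'p vert) set)"
  unfolding internal_semidirect_def
proof (intro conjI)
  show "subgroup (Lin C) (perm_group UNIV (Aff C :: ('p vert \<Rightarrow> 'p vert) set))"
    unfolding subgroup_perm_group[OF subgroup_Aff[OF C]] using subgroup_Lin[OF C] Lin_subset_Aff by blast
  have "g = id" if g: "g \<in> N_group" "g \<in> Lin C" for g :: "'p vert \<Rightarrow> 'p vert"
  proof -
    obtain u v where uv: "g = transl u v"
      using g(1) by (auto simp: N_group_def)
    have "g (0, 0, 0) = (0, 0, snd (snd (g (0, 0, 0))))"
      using g(2) by (auto simp: aff_origin elim!: LinE)
    then show ?thesis
      by (simp add: uv transl_def id_def)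
  qed
  moreover have "id \<in> N_group" "id \<in> Lin C"
    using subgroup.one_closed[OF subgroup_N] subgroup.one_closed[OF subgroup_Lin[OF C]] by simp_all
  ultimately show "N_group \<inter> Lin C = {\<one>\<^bsub>perm_group UNIV (Aff C :: ('p vert \<Rightarrow> 'p vert) set)\<^esub>}"
    by auto
  show "N_group <#>\<^bsub>perm_group UNIV (Aff C)\<^esub> Lin C = carrier (perm_group UNIV (Aff C :: ('p vert \<Rightarrow> 'p vert) set))"
    using set_mult_N_Lin[of C, where ?'a = 'p] by (simp add: set_mult_def)
qed (rule normal_N[OF C])

lemma N_iso:
  "perm_group UNIV (N_group :: ('p::prime_card vert \<Rightarrow> 'p vert) set) \<cong>
    integer_mod_group CARD('p) \<times>\<times> integer_mod_group CARD('p)"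
proof (rule is_isoI, rule isoI)
  define h :: "('p vert \<Rightarrow> 'p vert) \<Rightarrow> int \<times> int" where
    "h g = (to_int_mod_ring (fst (g (0, 0, 0))), to_int_mod_ring (fst (snd (g (0, 0, 0)))))" for g
  have h: "h (transl u v) = (to_int_mod_ring u, to_int_mod_ring v)" for u v
    by (simp add: h_def transl_def)
  have carrier: "carrier (integer_mod_group CARD('p)) = range (to_int_mod_ring :: 'p mod_ring \<Rightarrow> int)"
    by (simp add: carrier_integer_mod_group range_to_int_mod_ring)
  show "h \<in> hom (perm_group UNIV N_group) (integer_mod_group CARD('p) \<times>\<times> integer_mod_group CARD('p))"
    by (auto simp: hom_def N_group_def h carrier mult_BijGroup_UNIV transl_bij transl_comp to_int_mod_ring_add)
  show "bij_betw h (carrier (perm_group UNIV N_group)) (carrier (integer_mod_group CARD('p) \<times>\<times> integer_mod_group CARD('p)))"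
    unfolding bij_betw_def
  proof
    show "inj_on h (carrier (perm_group UNIV N_group))"
      by (auto simp: inj_on_def N_group_def h)
    have "(to_int_mod_ring u, to_int_mod_ring v) \<in> h ` N_group" for u v :: "'p mod_ring"
      using h transl_in_N by (metis imageI)
    then show "h ` carrier (perm_group UNIV N_group) = carrier (integer_mod_group CARD('p) \<times>\<times> integer_mod_group CARD('p))"
      by (auto simp: N_group_def h carrier)
  qed
qed

text \<open>The diagonal of the Klein four-group: it meets both \<open>s = True\<close> and
  \<open>d = 1\<close>, but avoids \<open>(True, 0)\<close>.\<close>

definition G_types :: "(bool \<times> bit) set" where
  "G_types = {(False, 0), (True, 1)}"

lemma type_subgroup_G: "type_subgroup G_types"
  by (auto simp: type_subgroup_def G_types_def)

section \<open>Generators of the complements\<close>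

context cube_root
begin

lemma generate_Lin:
  assumes C: "type_subgroup C" and X: "X \<subseteq> Lin C" "tau a \<in> X"
    and gen: "\<And>s d. (s, d) \<in> C \<Longrightarrow> aff 1 s d 0 0 \<in> generate (BijGroup UNIV) X"
  shows "generate (BijGroup UNIV) X = Lin C"
proof
  show "generate (BijGroup UNIV) X \<subseteq> Lin C"
    using group.generate_subgroup_incl[OF group_BijGroup X(1) subgroup_Lin[OF C]] .
  have comp: "g \<circ> h \<in> generate (BijGroup UNIV) X"
    if "g \<in> generate (BijGroup UNIV) X" "h \<in> generate (BijGroup UNIV) X" for g h
  proof -
    have "bij g" "bij h"
      using that \<open>generate (BijGroup UNIV) X \<subseteq> Lin C\<close> Lin_subset_Aff Aff_bij by blast+
    then show ?thesis
      using generate.eng[OF that] by (simp add: mult_BijGroup_UNIV)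
  qed
  have diag: "aff r False 0 0 0 \<in> generate (BijGroup UNIV) X" if "r ^ 3 = 1" for r
  proof -
    have a: "aff a False 0 0 0 \<in> generate (BijGroup UNIV) X"
      using generate.incl[OF X(2)] by (simp add: tau_aff)
    moreover have "aff (a\<^sup>2) False 0 0 0 \<in> generate (BijGroup UNIV) X"
      using comp[OF a a] by (simp add: aff_comp[OF a_cube] power2_eq_square)
    moreover have "aff 1 False 0 0 0 \<in> generate (BijGroup UNIV) X"
      using gen C by (simp add: type_subgroup_def)
    ultimately show ?thesis
      using that unfolding cube_roots by blast
  qed
  show "Lin C \<subseteq> generate (BijGroup UNIV) X"
  proof
    fix g :: "'p vert \<Rightarrow> 'p vert" assume "g \<in> Lin C"
    then obtain r s d where g: "g = aff r s d 0 0" "r ^ 3 = 1" "(s, d) \<in> C"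
      by (elim LinE)
    have "aff r False 0 0 0 \<circ> aff 1 s d 0 0 = g"
      by (simp add: aff_comp g)
    then show "g \<in> generate (BijGroup UNIV) X"
      using comp[OF diag[OF g(2)] gen[OF g(3)]] by simp
  qed
qed

lemma G_compl_eq: "G_compl a = Lin G_types"
  unfolding G_compl_def
proof (rule generate_Lin[OF type_subgroup_G])
  show "{tau a, sigma \<circ> nu} \<subseteq> Lin G_types"
    unfolding tau_aff sigma_nu_aff using a_cube by (auto simp: G_types_def intro!: aff_in_Lin)
  have "sigma \<circ> nu \<in> generate (BijGroup UNIV) {tau a, sigma \<circ> nu}"
    by (intro generate.incl) simp
  then show "aff 1 s d 0 0 \<in> generate (BijGroup UNIV) {tau a, sigma \<circ> nu}" if "(s, d) \<in> G_types" for s d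
    using that generate.one[of "BijGroup UNIV" "{tau a, sigma \<circ> nu}"]
    by (auto simp: G_types_def sigma_nu_aff aff_id)
qed simp

lemma A_compl_eq: "A_compl a = Lin UNIV"
  unfolding A_compl_def
proof (rule generate_Lin[OF type_subgroup_UNIV])
  let ?H = "generate (BijGroup UNIV) {tau a, sigma, nu}"
  show "{tau a, sigma, nu} \<subseteq> Lin UNIV"
    unfolding tau_aff sigma_aff nu_aff using a_cube by (auto intro!: aff_in_Lin)
  have "sigma \<in> ?H" "nu \<in> ?H"
    by (auto intro!: generate.incl)
  moreover have "sigma \<circ> nu \<in> ?H"
    using generate.eng[OF calculation] by (simp add: mult_BijGroup_UNIV sigma_aff nu_aff bij_aff)
  ultimately show "aff 1 s d 0 0 \<in> ?H" for s d
    using generate.one[of "BijGroup UNIV" "{tau a, sigma, nu}"]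
    by (cases s; cases d) (simp_all add: aff_id flip: sigma_nu_aff sigma_aff nu_aff)
qed simp

lemma G_group_eq: "G_group a = Aff G_types"
  by (simp add: G_group_def G_compl_eq set_mult_N_Lin)

lemma A_group_eq: "A_group a = Aff UNIV"
  by (simp add: A_group_def A_compl_eq set_mult_N_Lin)

section \<open>The complements act on the cube roots of unity\<close>

text \<open>The exponent of \<open>a\<close>, taken in {1, 2, 3} to match the points of
  \<open>sym_group 3\<close>; hence the root 1 has index 3, which is also the default outside the
  roots.\<close>

definition root_index :: "'p mod_ring \<Rightarrow> nat" where
  "root_index q = (if q = a then 1 else if q = a\<^sup>2 then 2 else 3)"

definition root_perm :: "'p mod_ring \<Rightarrow> bool \<Rightarrow> nat \<Rightarrow> nat" where
  "root_perm r s i = (if i \<in> {1..3} then root_index (r * (if s then (a ^ i)\<^sup>2 else a ^ i)) else i)"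

text \<open>Recovers the permutation of labels from the map alone, since an isomorphism must not
  depend on the parameters: the neighbour offsets are evaluated, and the image of the origin tells
  which sign to remove.\<close>

definition root_action :: "('p vert \<Rightarrow> 'p vert) \<Rightarrow> nat \<Rightarrow> nat" where
  "root_action g i = (if i \<in> {1..3}
     then root_index (sg (snd (snd (g (0, 0, 0)))) * fst (g (a ^ i, (a ^ i)\<^sup>2, 0))) else i)"

lemma root_action_aff: "root_action (aff r s d 0 0) = root_perm r s"
  by (auto simp: root_action_def root_perm_def aff_def fun_eq_iff mult.assoc)

lemma root_index_range: "root_index q \<in> {1..3}"
  by (simp add: root_index_def)

lemma power_root_index: "q ^ 3 = 1 \<Longrightarrow> a ^ root_index q = q"
  unfolding cube_roots by (auto simp: root_index_def a_cube)

lemma root_index_power: "i \<in> {1..3} \<Longrightarrow> root_index (a ^ i) = i"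
proof -
  assume "i \<in> {1..3}"
  then have "i = 1 \<or> i = 2 \<or> i = 3"
    by auto
  then show ?thesis
    using a_cube a_neq_1 a2_neq_1 a_neq_1[symmetric] a2_neq_1[symmetric] by (auto simp: root_index_def)
qed

lemma power_cube: "(a ^ i) ^ 3 = 1"
  by (metis a_cube mult.commute power_mult power_one)

lemma root_perm_arg:
  assumes "r ^ 3 = 1"
  shows "(r * (if s then (a ^ i)\<^sup>2 else a ^ i)) ^ 3 = 1"
  using cube_mult[OF assms power_cube] cube_mult[OF assms cube_square[OF power_cube]] by simp

lemma root_perm_power:
  "r ^ 3 = 1 \<Longrightarrow> i \<in> {1..3} \<Longrightarrow> a ^ root_perm r s i = r * (if s then (a ^ i)\<^sup>2 else a ^ i)"
  by (simp only: root_perm_def if_True power_root_index[OF root_perm_arg])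

lemma root_perm_comp:
  assumes "r ^ 3 = 1" "r' ^ 3 = 1"
  shows "root_perm r s \<circ> root_perm r' s' = root_perm (r * (if s then r'\<^sup>2 else r')) (s \<noteq> s')"
proof
  fix i
  show "(root_perm r s \<circ> root_perm r' s') i = root_perm (r * (if s then r'\<^sup>2 else r')) (s \<noteq> s') i"
  proof (cases "i \<in> {1..3}")
    case True
    note 4 = cube_fourth[OF power_cube, of i]
    have "root_perm r' s' i \<in> {1..3}"
      using True root_index_range by (simp only: root_perm_def if_True)
    then have "root_perm r s (root_perm r' s' i) =
        root_index (r * (if s then (a ^ root_perm r' s' i)\<^sup>2 else a ^ root_perm r' s' i))"
      by (simp only: root_perm_def[of r] if_True)
    also have "\<dots> = root_perm (r * (if s then r'\<^sup>2 else r')) (s \<noteq> s') i"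
      unfolding root_perm_power[OF assms(2) True] root_perm_def[of "r * _"]
      using True 4 by (cases s; cases s') (simp_all only: if_True if_False power_mult_distrib mult.assoc simp_thms)
    finally show ?thesis
      by simp
  next
    case False
    then show ?thesis
      by (simp only: root_perm_def if_False comp_apply)
  qed
qed

lemma root_perm_permutes:
  assumes r: "r ^ 3 = 1"
  shows "root_perm r s permutes {1..3}"
proof (rule bij_imp_permutes)
  have "inj_on (root_perm r s) {1..3}"
  proof
    fix i j assume ij: "i \<in> {1..3}" "j \<in> {1..3}" "root_perm r s i = root_perm r s j"
    have "r \<noteq> 0"
      using r by auto
    moreover have "r * (if s then (a ^ i)\<^sup>2 else a ^ i) = r * (if s then (a ^ j)\<^sup>2 else a ^ j)"
      using root_perm_power[OF r] ij by metis
    ultimately have "(if s then (a ^ i)\<^sup>2 else a ^ i) = (if s then (a ^ j)\<^sup>2 else a ^ j)"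
      by simp
    \<comment> \<open>On cube roots of unity squaring is inversion, hence injective.\<close>
    moreover have "q = q'" if "q\<^sup>2 = q'\<^sup>2" "q ^ 3 = 1" "q' ^ 3 = 1" for q q' :: "'p mod_ring"
      using that cube_fourth by metis
    ultimately have "a ^ i = a ^ j"
      using power_cube by (cases s) auto
    then show "i = j"
      using root_index_power ij(1,2) by metis
  qed
  moreover have "root_perm r s ` {1..3} \<subseteq> {1..3}"
    unfolding root_perm_def using root_index_range by auto
  ultimately show "bij_betw (root_perm r s) {1..3} {1..3}"
    by (simp add: bij_betw_def endo_inj_surj)
qed (simp only: root_perm_def if_False)

text \<open>Index 3 stands for the root 1, whose image is \<open>r\<close> whatever \<open>s\<close>
  is; index 1 stands for \<open>a\<close>, whose image then gives \<open>s\<close> because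
  \<open>a\<close> and \<open>a\<^sup>2\<close> differ.\<close>

lemma root_perm_inject:
  assumes "root_perm r s = root_perm r' s'" "r ^ 3 = 1" "r' ^ 3 = 1"
  shows "r = r' \<and> s = s'"
proof -
  have eq: "r * (if s then (a ^ i)\<^sup>2 else a ^ i) = r' * (if s' then (a ^ i)\<^sup>2 else a ^ i)" if "i \<in> {1..3}" for i
    using root_perm_power[OF assms(2) that, of s] root_perm_power[OF assms(3) that, of s'] assms(1) by simp
  have "r = r'"
    using eq[of 3] by (simp add: a_cube split: if_splits)
  moreover from this have "s = s'"
    using eq[of 1] assms(2) by (auto split: if_splits)
  ultimately show ?thesis
    by simp
qed

text \<open>By counting: three roots and two values of \<open>s\<close> give six distinct
  permutations of three points, which is all of them.\<close>

lemma root_perm_surj: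
  assumes "p permutes {1..3}"
  obtains r s where "r ^ 3 = 1" "p = root_perm r s"
proof -
  define P where "P = {1, a, a\<^sup>2} \<times> (UNIV :: bool set)"
  have "inj_on (\<lambda>(r, s). root_perm r s) P"
  proof (rule inj_onI)
    fix x y assume "x \<in> P" "y \<in> P" and eq: "(\<lambda>(r, s). root_perm r s) x = (\<lambda>(r, s). root_perm r s) y"
    then have "fst x ^ 3 = 1" "fst y ^ 3 = 1"
      by (auto simp: P_def cube_roots)
    then show "x = y"
      using eq root_perm_inject[of "fst x" "snd x" "fst y" "snd y"] by (simp add: case_prod_beta prod_eq_iff)
  qed
  moreover have "card P = 6"
    using a_neq_1[symmetric] a2_neq_1[symmetric] by (simp add: P_def card_cartesian_product)
  ultimately have "card ((\<lambda>(r, s). root_perm r s) ` P) = 6"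
    by (simp add: card_image)
  moreover have "card {p. p permutes {1..3::nat}} = 6"
    using card_permutations[of "{1..3::nat}" 3] by (simp add: fact_numeral)
  moreover have "(\<lambda>(r, s). root_perm r s) ` P \<subseteq> {p. p permutes {1..3}}"
    using root_perm_permutes by (auto simp: P_def cube_roots)
  ultimately have "(\<lambda>(r, s). root_perm r s) ` P = {p. p permutes {1..3}}"
    by (intro card_subset_eq) (auto intro: finite_permutations)
  then have "p \<in> (\<lambda>(r, s). root_perm r s) ` P"
    using assms by blast
  then obtain r s where "r \<in> {1, a, a\<^sup>2}" "p = root_perm r s"
    by (auto simp: P_def)
  then show thesis
    using that by (auto simp: cube_roots)
qed

text \<open>In \<open>G_types\<close> the value of \<open>d\<close> is determined by
  \<open>s\<close>, so the action on the labels is faithful.\<close>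

lemma G_compl_iso: "perm_group UNIV (G_compl a) \<cong> sym_group 3"
  unfolding G_compl_eq
proof (rule is_isoI, rule isoI)
  show "root_action \<in> hom (perm_group UNIV (Lin G_types)) (sym_group 3)"
    by (auto simp: hom_def sym_group_def mult_BijGroup_UNIV bij_aff aff_comp root_action_aff
        root_perm_permutes root_perm_comp simp del: One_nat_def elim!: LinE)
  show "bij_betw root_action (carrier (perm_group UNIV (Lin G_types))) (carrier (sym_group 3))"
    unfolding bij_betw_def
  proof
    show "inj_on root_action (carrier (perm_group UNIV (Lin G_types)))"
    proof
      fix g h assume "g \<in> carrier (perm_group UNIV (Lin G_types))" "h \<in> carrier (perm_group UNIV (Lin G_types))"
        and eq: "root_action g = root_action h"
      then obtain r s d r' s' d' where gh: "g = aff r s d 0 0" "r ^ 3 = 1" "(s, d) \<in> G_types"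
          "h = aff r' s' d' 0 0" "r' ^ 3 = 1" "(s', d') \<in> G_types"
        by (auto elim!: LinE)
      then have "r = r' \<and> s = s'"
        using eq root_perm_inject by (simp add: root_action_aff)
      then show "g = h"
        using gh by (auto simp: G_types_def)
    qed
    show "root_action ` carrier (perm_group UNIV (Lin G_types)) = carrier (sym_group 3)"
    proof
      show "root_action ` carrier (perm_group UNIV (Lin G_types)) \<subseteq> carrier (sym_group 3)"
        by (auto simp: sym_group_def root_action_aff root_perm_permutes simp del: One_nat_def elim!: LinE)
      show "carrier (sym_group 3) \<subseteq> root_action ` carrier (perm_group UNIV (Lin G_types))"
      proof
        fix p assume "p \<in> carrier (sym_group 3)"
        then obtain r s where r: "r ^ 3 = 1" "p = root_perm r s"
          using root_perm_surj by (auto simp: sym_group_def)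
        \<comment> \<open>The one value of \<open>d\<close> for which \<open>(s, d)\<close> lies on
          the diagonal.\<close>
        have "aff r s (if s then 1 else 0) 0 0 \<in> Lin G_types"
          using r by (intro aff_in_Lin) (auto simp: G_types_def)
        then show "p \<in> root_action ` carrier (perm_group UNIV (Lin G_types))"
          using r(2) root_action_aff by (metis carrier_perm_group imageI)
      qed
    qed
  qed
qed

text \<open>With all types allowed, \<open>d\<close> is independent of the label permutation and
  additive under composition, which gives the factor of order two.\<close>

lemma A_compl_iso: "perm_group UNIV (A_compl a) \<cong> sym_group 3 \<times>\<times> integer_mod_group 2"
  unfolding A_compl_eq
proof (rule is_isoI, rule isoI)
  define flip :: "bit \<Rightarrow> int" where "flip d = (if d = 0 then 0 else 1)" for d
  define h :: "('p vert \<Rightarrow> 'p vert) \<Rightarrow> (nat \<Rightarrow> nat) \<times> int" where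
    "h g = (root_action g, flip (snd (snd (g (0, 0, 0)))))" for g
  have h: "h (aff r s d 0 0) = (root_perm r s, flip d)" for r s d
    by (simp add: h_def root_action_aff aff_origin)
  have flip_add: "flip (d + d') = (flip d + flip d') mod 2" for d d'
    by (cases d; cases d') (simp_all add: flip_def)
  have flip_range: "flip d \<in> carrier (integer_mod_group 2)" for d
    by (simp add: flip_def carrier_integer_mod_group)
  have flip_surj: "\<exists>d. z = flip d" if "z \<in> carrier (integer_mod_group 2)" for z
  proof -
    have "z = 0 \<or> z = 1"
      using that by (auto simp: carrier_integer_mod_group)
    then show ?thesis
      by (metis flip_def one_neq_zero)
  qed
  show "h \<in> hom (perm_group UNIV (Lin UNIV)) (sym_group 3 \<times>\<times> integer_mod_group 2)"
    by (auto simp: hom_def sym_group_def mult_BijGroup_UNIV bij_aff aff_comp h flip_add flip_range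
        root_perm_permutes root_perm_comp simp del: One_nat_def elim!: LinE)
  show "bij_betw h (carrier (perm_group UNIV (Lin UNIV))) (carrier (sym_group 3 \<times>\<times> integer_mod_group 2))"
    unfolding bij_betw_def
  proof
    show "inj_on h (carrier (perm_group UNIV (Lin UNIV)))"
    proof
      fix g g' assume "g \<in> carrier (perm_group UNIV (Lin UNIV))" "g' \<in> carrier (perm_group UNIV (Lin UNIV))"
        and eq: "h g = h g'"
      then obtain r s d r' s' d' where gh: "g = aff r s d 0 0" "r ^ 3 = 1"
          "g' = aff r' s' d' 0 0" "r' ^ 3 = 1"
        by (auto elim!: LinE)
      then have perm: "root_perm r s = root_perm r' s'" and "flip d = flip d'"
        using eq by (simp_all add: h)
      moreover have "r = r' \<and> s = s'"
        using root_perm_inject[OF perm] gh by blast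
      ultimately show "g = g'"
        using gh by (cases d; cases d') (simp_all add: flip_def)
    qed
    show "h ` carrier (perm_group UNIV (Lin UNIV)) = carrier (sym_group 3 \<times>\<times> integer_mod_group 2)"
    proof
      show "h ` carrier (perm_group UNIV (Lin UNIV)) \<subseteq> carrier (sym_group 3 \<times>\<times> integer_mod_group 2)"
        by (auto simp: sym_group_def h flip_range root_perm_permutes simp del: One_nat_def elim!: LinE)
      show "carrier (sym_group 3 \<times>\<times> integer_mod_group 2) \<subseteq> h ` carrier (perm_group UNIV (Lin UNIV))"
      proof
        fix y assume y: "y \<in> carrier (sym_group 3 \<times>\<times> integer_mod_group 2)"
        then have p: "fst y permutes {1..3}" and z: "snd y \<in> carrier (integer_mod_group 2)"
          by (auto simp: sym_group_def)
        obtain r s where r: "r ^ 3 = 1" "fst y = root_perm r s"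
          using root_perm_surj[OF p] .
        obtain d where d: "snd y = flip d"
          using flip_surj[OF z] by blast
        have "h (aff r s d 0 0) = y"
          using r(2) d by (simp add: h prod_eq_iff)
        then show "y \<in> h ` carrier (perm_group UNIV (Lin UNIV))"
          using aff_in_Lin[OF r(1), of s d UNIV] by (metis UNIV_I carrier_perm_group imageI)
      qed
    qed
  qed
qed

end

theorem proposition3p2:
  fixes a :: "'p::prime_card mod_ring"
  assumes "[CARD('p) = 1] (mod 3)"
    and "has_mult_order a 3"
  defines "V \<equiv> (UNIV :: 'p vert set)"
    and "E \<equiv> Sigma_edges a"
    and "N \<equiv> (N_group :: ('p vert \<Rightarrow> 'p vert) set)"
    and "G \<equiv> G_group a"
    and "A \<equiv> A_group a"
  shows
    "((\<forall>u v. transl u v \<in> automorphisms V E) \<and>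
      {tau a, sigma, nu} \<subseteq> automorphisms V E \<and>
      subgroup N (BijGroup V) \<and>
      perm_group V N \<cong> integer_mod_group CARD('p) \<times>\<times> integer_mod_group CARD('p)) \<and>
     (subgroup G (BijGroup V) \<and> G \<subseteq> automorphisms V E \<and>
      internal_semidirect (perm_group V G) N (G_compl a) \<and>
      perm_group V (G_compl a) \<cong> sym_group 3) \<and>
     biquasiprimitive V G \<and>
     (perm_orbits V (plus_subgroup V G) = {half 0, half 1} \<and>
      \<not> quasiprimitive_on (plus_subgroup V G) (half 0 :: 'p vert set) \<and>
      \<not> quasiprimitive_on (plus_subgroup V G) (half 1 :: 'p vert set)) \<and>
     arc_transitive V E G 1 \<and> \<not> arc_transitive V E G 2 \<and>
     (subgroup A (BijGroup V) \<and> automorphisms V E = A \<and>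
      internal_semidirect (perm_group V A) N (A_compl a) \<and>
      perm_group V (A_compl a) \<cong> sym_group 3 \<times>\<times> integer_mod_group 2) \<and>
     arc_transitive V E A 2 \<and>
     biquasiprimitive V A \<and>
     (perm_orbits V (plus_subgroup V A) = {half 0, half 1} \<and>
      quasiprimitive_on (plus_subgroup V A) (half 0 :: 'p vert set) \<and>
      quasiprimitive_on (plus_subgroup V A) (half 1 :: 'p vert set))"
proof -
  interpret cube_root a
    by (rule cube_root.intro[OF assms(2)])
  \<comment> \<open>The missing type accounts for both negative statements about G; the present one
    supplies both the swap and the exchange of halves for biquasiprimitivity.\<close>
  have G: "(True, 0) \<notin> G_types" "(True, 1) \<in> G_types"
    by (simp_all add: G_types_def)
  have G': "\<exists>s. (s, d) \<in> G_types" for d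
    by (cases d) (auto simp: G_types_def)
  have "(\<forall>u v. transl u v \<in> automorphisms V E) \<and>
      {tau a, sigma, nu} \<subseteq> automorphisms V E \<and>
      subgroup N (BijGroup V) \<and>
      perm_group V N \<cong> integer_mod_group CARD('p) \<times>\<times> integer_mod_group CARD('p)"
    unfolding V_def E_def N_def automorphisms_eq transl_aff tau_aff sigma_aff nu_aff
    using a_cube subgroup_N N_iso by (auto intro!: aff_in_Aff)
  moreover have "subgroup G (BijGroup V) \<and> G \<subseteq> automorphisms V E \<and>
      internal_semidirect (perm_group V G) N (G_compl a) \<and>
      perm_group V (G_compl a) \<cong> sym_group 3"
    unfolding V_def E_def N_def G_def G_group_eq G_compl_eq
    by (intro conjI subgroup_Aff Aff_automorphisms internal_semidirect_Aff G_compl_iso[unfolded G_compl_eq] type_subgroup_G)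
  moreover have "biquasiprimitive V G"
    unfolding V_def G_def G_group_eq by (rule biquasiprimitive_Aff[OF type_subgroup_G G(2) G(2)])
  moreover have "perm_orbits V (plus_subgroup V G) = {half 0, half 1} \<and>
      \<not> quasiprimitive_on (plus_subgroup V G) (half 0 :: 'p vert set) \<and>
      \<not> quasiprimitive_on (plus_subgroup V G) (half 1 :: 'p vert set)"
    unfolding V_def G_def G_group_eq plus_subgroup_Aff[OF type_subgroup_G]
    using orbits_plus[OF type_subgroup_G] not_quasiprimitive_on_half[OF type_subgroup_G G(1)] by blast
  moreover have "arc_transitive V E G 1"
    unfolding V_def E_def G_def G_group_eq by (rule arc_transitive_1[OF type_subgroup_G G'])
  moreover have "\<not> arc_transitive V E G 2"
    unfolding V_def E_def G_def G_group_eq by (rule not_arc_transitive_2[OF G(1)])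
  moreover have "subgroup A (BijGroup V) \<and> automorphisms V E = A \<and>
      internal_semidirect (perm_group V A) N (A_compl a) \<and>
      perm_group V (A_compl a) \<cong> sym_group 3 \<times>\<times> integer_mod_group 2"
    unfolding V_def E_def N_def A_def A_group_eq A_compl_eq
    by (intro conjI subgroup_Aff automorphisms_eq internal_semidirect_Aff A_compl_iso[unfolded A_compl_eq] type_subgroup_UNIV)
  moreover have "arc_transitive V E A 2"
    unfolding V_def E_def A_def A_group_eq by (rule arc_transitive_2)
  moreover have "biquasiprimitive V A"
    unfolding V_def A_def A_group_eq by (rule biquasiprimitive_Aff[OF type_subgroup_UNIV UNIV_I UNIV_I])
  moreover have "perm_orbits V (plus_subgroup V A) = {half 0, half 1} \<and>
      quasiprimitive_on (plus_subgroup V A) (half 0 :: 'p vert set) \<and>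
      quasiprimitive_on (plus_subgroup V A) (half 1 :: 'p vert set)"
    unfolding V_def A_def A_group_eq plus_subgroup_Aff[OF type_subgroup_UNIV]
    using orbits_plus[OF type_subgroup_UNIV] quasiprimitive_on_half[OF type_subgroup_UNIV UNIV_I] by blast
  ultimately show ?thesis
    by - (elim conjE, intro conjI)
qed

end
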